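(* Let $r\in\mathbb{N}_+$ and let $\{X_n:n\in\mathbb{N}\}$ be a sequence of real random variables with an $r$-max-regenerative structure (with regeneration times $S_n$, cycle lengths $Y_n$ and cycle maxima $\zeta_n^{(i)}$, $\zeta_n=\zeta_n^{(1)}$, as defined in the context) such that $\mu:=\operatorname{E}Y_1<\infty$ and $$\operatorname{P}\left(\zeta_0>\max_{1\leqslant k\leqslant n}\zeta_k\right)\to 0\quad\text{as } n\to\infty .$$ Let $G(x):=\operatorname{P}(\zeta_1\leqslant x)^{1/\mu}$ and $\beta_i(x):=\operatorname{P}\left(\zeta_1^{(i+1)}\leqslant x<\zeta_1^{(i)}\,\big|\,\zeta_1>x\right)$ for $x\in\mathbb{R}$ and $i\in\{1,2,\ldots,r-1\}$. Then, for every $q\in\{2,3,\ldots,r\}$, $$\sup_{x\in\mathbb{R}}\left|\operatorname{P}\left(M_n^{(q)}\leqslant x\right)-G(x)^n\sum_{k=0}^{q-1}\frac{\left(-\log G(x)^n\right)^k}{k!}\gamma_{q,k}(x)\right|\to 0\quad\text{as } n\to\infty,$$ where $M_n^{(q)}$ is the $q$-th largest value among $X_1,\ldots,X_n$ and $\gamma_{q,k}(x)\in[0,1]$ is given by $$\gamma_{q,k}(x):=\sum_{(j_1,j_2,\ldots,j_{q-1})\in J_{q,k}}\frac{k!}{j_1!j_2!\cdots j_{q-1}!}\,\beta_1(x)^{j_1}\beta_2(x)^{j_2}\cdots\beta_{q-1}(x)^{j_{q-1}},$$ with $J_{q,k}:=\left\{(j_1,\ldots,j_{q-1})\in\mathbb{N}^{q-1}:\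 \sum_{i=1}^{q-1}j_i=k,\ \sum_{i=1}^{q-1}i\,j_i\leqslant q-1\right\}$.
   Context: Here $\mathbb{N}=\{0,1,2,\ldots\}$ and $\mathbb{N}_+=\{1,2,\ldots\}$. Order statistics: $M_n^{(q)}$ denotes the $q$-th largest value (counted with multiplicity) of $X_1,X_2,\ldots,X_n$ if $q\leqslant n$, and $M_n^{(q)}:=-\infty$ if $q>n$. $r$-max-regenerative structure: for $r\in\mathbb{N}_+$, the sequence $\{X_n:n\in\mathbb{N}\}$ has an $r$-max-regenerative structure if there exist integer-valued random variables $0<S_0<S_1<\cdots$ (with $S_{-1}:=0$), called regeneration times, with the following properties. For $n\geqslant 0$ let $C_n:=\{X_k:S_{n-1}\leqslant k<S_n\}$ be the $n$-th cycle, of length $Y_n:=S_n-S_{n-1}$, and let $\zeta_n^{(1)}\geqslant\zeta_n^{(2)}\geqslant\cdots\geqslant\zeta_n^{(r)}$ be the first $r$ maxima (largest values, counted with multiplicity) in the cycle $C_n$, where $\zeta_n:=\zeta_n^{(1)}$ and $\zeta_n^{(q)}:=-\infty$ if $q>Y_n$. It is required that (1) the $Y_n$ are independent for $n\geqslant 0$ and identically distributed for $n\geqslant 1$; (2) the vectors $(\zeta_n,\zeta_n^{(2)},\ldots,\zeta_n^{(r)})$ are independent for $n\geqslant 0$ and identically distributed for $n\geqslant 1$. Conventions for degenerate $x$: if $G(x)=0$, the expression $G(x)^n(-\log G(x)^n)^k$ is read as $0$ (its limit as $G(x)\searrow 0$); if $\operatorname{P}(\zeta_1>x)=0$, then $G(x)=1$,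 so only the $k=0$ term of the sum is nonzero and the values $\beta_i(x)$ (undefined there) play no role; $0^0=1$, so $\gamma_{q,0}(x)=1$. *)

theory Defs
  imports "HOL-Probability.Probability"
begin

text \<open>
  The \<open>q\<close>-th largest value, counted with multiplicity, of the finite family \<open>(f k)\<close>, \<open>k \<in> A\<close>,
  for \<open>q \<ge> 1\<close> (the value for \<open>q = 0\<close> is never used).
\<close>

definition kth_largest :: "nat \<Rightarrow> (nat \<Rightarrow> real) \<Rightarrow> nat set \<Rightarrow> ereal" where
  "kth_largest q f A =
     (if q \<le> card A
      then ereal (rev (sorted_list_of_multiset (image_mset f (mset_set A))) ! (q - 1))
      else -\<infinity>)"

definition order_stat :: "(nat \<Rightarrow> 'a \<Rightarrow> real) \<Rightarrow> nat \<Rightarrow> nat \<Rightarrow> 'a \<Rightarrow> ereal" where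
  "order_stat X q n \<omega> = kth_largest q (\<lambda>k. X k \<omega>) {1..n}"

text \<open>The preceding regeneration time \<open>S\<^sub>n\<^sub>-\<^sub>1\<close>, with the convention \<open>S\<^sub>-\<^sub>1 = 0\<close>.\<close>

definition cycle_start :: "(nat \<Rightarrow> 'a \<Rightarrow> nat) \<Rightarrow> nat \<Rightarrow> 'a \<Rightarrow> nat" where
  "cycle_start S n \<omega> = (if n = 0 then 0 else S (n - 1) \<omega>)"

definition cycle_length :: "(nat \<Rightarrow> 'a \<Rightarrow> nat) \<Rightarrow> nat \<Rightarrow> 'a \<Rightarrow> nat" where
  "cycle_length S n \<omega> = S n \<omega> - cycle_start S n \<omega>"

definition cycle_max ::
  "(nat \<Rightarrow> 'a \<Rightarrow> real) \<Rightarrow> (nat \<Rightarrow> 'a \<Rightarrow> nat) \<Rightarrow> nat \<Rightarrow> nat \<Rightarrow> 'a \<Rightarrow> ereal" where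
  "cycle_max X S i n \<omega> = kth_largest i (\<lambda>k. X k \<omega>) {cycle_start S n \<omega>..<S n \<omega>}"

text \<open>
  \<open>S\<close> is a sequence of regeneration times witnessing the \<open>r\<close>-max-regenerative structure of \<open>X\<close>.
  The cycle lengths and the vectors of cycle maxima are each independent over the cycles;
  nothing is required about their joint law.
\<close>

definition max_regenerative ::
  "'a measure \<Rightarrow> nat \<Rightarrow> (nat \<Rightarrow> 'a \<Rightarrow> real) \<Rightarrow> (nat \<Rightarrow> 'a \<Rightarrow> nat) \<Rightarrow> bool" where
  "max_regenerative M r X S \<longleftrightarrow>
     (\<forall>n. S n \<in> measurable M (count_space UNIV)) \<and>
     (AE \<omega> in M. 0 < S 0 \<omega> \<and> (\<forall>n. S n \<omega> < S (Suc n) \<omega>)) \<and>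
     prob_space.indep_vars M (\<lambda>_. count_space UNIV) (cycle_length S) UNIV \<and>
     (\<forall>n\<ge>1. distr M (count_space UNIV) (cycle_length S n)
           = distr M (count_space UNIV) (cycle_length S 1)) \<and>
     prob_space.indep_vars M (\<lambda>_. Pi\<^sub>M {1..r} (\<lambda>_. borel))
       (\<lambda>n \<omega>. \<lambda>i\<in>{1..r}. cycle_max X S i n \<omega>) UNIV \<and>
     (\<forall>n\<ge>1. distr M (Pi\<^sub>M {1..r} (\<lambda>_. borel)) (\<lambda>\<omega>. \<lambda>i\<in>{1..r}. cycle_max X S i n \<omega>)
           = distr M (Pi\<^sub>M {1..r} (\<lambda>_. borel)) (\<lambda>\<omega>. \<lambda>i\<in>{1..r}. cycle_max X S i 1 \<omega>))"

definition mean_cycle_length :: "'a measure \<Rightarrow> (nat \<Rightarrow> 'a \<Rightarrow> nat) \<Rightarrow> real" where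
  "mean_cycle_length M S = (\<integral>\<omega>. real (cycle_length S 1 \<omega>) \<partial>M)"

definition phantom_G ::
  "'a measure \<Rightarrow> (nat \<Rightarrow> 'a \<Rightarrow> real) \<Rightarrow> (nat \<Rightarrow> 'a \<Rightarrow> nat) \<Rightarrow> real \<Rightarrow> real" where
  "phantom_G M X S x =
     \<P>(\<omega> in M. cycle_max X S 1 1 \<omega> \<le> ereal x) powr (1 / mean_cycle_length M S)"

text \<open>Equal to \<open>0\<close> if the conditioning event has probability \<open>0\<close>.\<close>

definition cycle_beta ::
  "'a measure \<Rightarrow> (nat \<Rightarrow> 'a \<Rightarrow> real) \<Rightarrow> (nat \<Rightarrow> 'a \<Rightarrow> nat) \<Rightarrow> nat \<Rightarrow> real \<Rightarrow> real" where
  "cycle_beta M X S i x =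
     \<P>(\<omega> in M. cycle_max X S (i + 1) 1 \<omega> \<le> ereal x \<and> ereal x < cycle_max X S i 1 \<omega>
        \<bar> cycle_max X S 1 1 \<omega> > ereal x)"

definition gamma_index :: "nat \<Rightarrow> nat \<Rightarrow> (nat \<Rightarrow> nat) set" where
  "gamma_index q k =
     {j \<in> {1..q - 1} \<rightarrow>\<^sub>E UNIV. (\<Sum>i=1..q - 1. j i) = k \<and> (\<Sum>i=1..q - 1. i * j i) \<le> q - 1}"

definition cycle_gamma ::
  "'a measure \<Rightarrow> (nat \<Rightarrow> 'a \<Rightarrow> real) \<Rightarrow> (nat \<Rightarrow> 'a \<Rightarrow> nat) \<Rightarrow> nat \<Rightarrow> nat \<Rightarrow> real \<Rightarrow> real" where
  "cycle_gamma M X S q k x =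
     (\<Sum>j\<in>gamma_index q k.
        fact k / (\<Prod>i=1..q - 1. fact (j i)) * (\<Prod>i=1..q - 1. cycle_beta M X S i x ^ j i))"

text \<open>
  As \<open>0 ^ n = 0\<close> for \<open>n \<ge> 1\<close>, every summand vanishes if \<open>phantom_G M X S x = 0\<close>,
  whatever the value of \<open>ln 0\<close>.
\<close>

definition order_stat_approx ::
  "'a measure \<Rightarrow> (nat \<Rightarrow> 'a \<Rightarrow> real) \<Rightarrow> (nat \<Rightarrow> 'a \<Rightarrow> nat) \<Rightarrow> nat \<Rightarrow> nat \<Rightarrow> real \<Rightarrow> real" where
  "order_stat_approx M X S q n x =
     phantom_G M X S x ^ n *
     (\<Sum>k=0..q - 1. (- ln (phantom_G M X S x ^ n)) ^ k / fact k * cycle_gamma M X S q k x)"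

end

theory Submission
  imports Defs "HOL-Real_Asymp.Real_Asymp"
begin

text \<open>
  The event that the \<open>q\<close>-th largest of \<open>X\<^sub>1, \<dots>, X\<^sub>n\<close> is at most \<open>x\<close> says that fewer than \<open>q\<close> of these values
  exceed \<open>x\<close>. By the law of large numbers about \<open>t = n / \<mu>\<close> cycles are completed by time \<open>n\<close>. The proof
  compares the number of exceedances up to time \<open>n\<close> with the total number in the cycles \<open>1, \<dots>, m\<close>, where \<open>m\<close>
  is deterministic and slightly smaller or slightly larger than \<open>t\<close> (\<open>order_stat_prob_le\<close>,
  \<open>order_stat_prob_ge\<close>). The cycle lengths may depend on the cycle maxima in any way; fixing \<open>m\<close> in advance
  is what makes this harmless.

  The exceedances in a cycle, counted up to \<open>r\<close>, are a function of the first \<open>r\<close> cycle maxima, hence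
  independent and identically distributed over the cycles \<open>1, 2, \<dots>\<close>. So the total number in \<open>m\<close> cycles is a
  compound binomial variable, and for levels below \<open>r\<close> counting only up to \<open>r\<close> changes nothing: with
  \<open>F = P(\<zeta>\<^sub>1 \<le> x)\<close>, each cycle has an exceedance with probability \<open>1 - F\<close>, and then \<open>i\<close> of them with probability \<open>\<beta>\<^sub>i(x)\<close>. The number \<open>\<gamma>\<^sub>q\<^sub>,\<^sub>k(x)\<close> is the probability that \<open>k\<close> cycles with
  exceedances have at most \<open>q - 1\<close> of them in total (\<open>jump_sum_cdf_Suc\<close>, \<open>excess_sum_cdf_eq\<close>); in particular it
  lies in the unit interval. The approximation in the theorem is the same expression with the
  binomial law of the number of cycles with exceedances replaced by the Poisson law with parameter
  \<open>- t * ln F\<close>.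

  Uniformity in \<open>x\<close> is thus a statement about binomial and Poisson probabilities, uniform in \<open>F\<close>
  (\<open>binomial_prob_uniform_approx\<close>): for \<open>F\<close> near 1 their ratio is close to 1, and for \<open>F\<close> bounded away from 1 both
  are exponentially small. It allows a small relative error between \<open>m\<close> and \<open>t\<close>.

  The initial cycle may have a different law. It matters only if it has exceedances while \<open>m\<close> later cycles have fewer
  than \<open>q\<close> in total, and then it dominates one of \<open>q\<close> blocks of later cycles, which is unlikely by
  hypothesis, uniformly in \<open>x\<close> (\<open>first_cycle_excess_bound\<close>).
\<close>

section \<open>The multinomial sums as distribution functions of sums of jumps\<close>

definition multiplicities :: "nat \<Rightarrow> nat \<Rightarrow> nat \<Rightarrow> (nat \<Rightarrow> nat) set" where
  "multiplicities N k s =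
     {j \<in> {1..N} \<rightarrow>\<^sub>E UNIV. (\<Sum>i=1..N. j i) = k \<and> (\<Sum>i=1..N. i * j i) \<le> s}"

text \<open>
  If \<open>b i\<close> is the probability that a jump has size \<open>i\<close>, this is the probability that \<open>k\<close> independent
  jumps add up to at most \<open>s\<close>, for \<open>s \<le> N\<close>: the multiplicity vector \<open>j\<close> says how often each size
  occurs, and sizes above \<open>N\<close> are too large to contribute. The bound \<open>N\<close> and the level \<open>s\<close> are separate
  parameters because recursion on \<open>k\<close> lowers the level while the range of the vectors stays fixed.
\<close>

definition jump_sum_cdf :: "(nat \<Rightarrow> real) \<Rightarrow> nat \<Rightarrow> nat \<Rightarrow> nat \<Rightarrow> real" where
  "jump_sum_cdf b N k s =
     (\<Sum>j\<in>multiplicities N k s.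
        fact k / (\<Prod>i=1..N. fact (j i)) * (\<Prod>i=1..N. b i ^ j i))"

lemma finite_multiplicities: "finite (multiplicities N k s)"
proof (rule finite_subset)
  show "multiplicities N k s \<subseteq> {1..N} \<rightarrow>\<^sub>E {..k}"
  proof
    fix j assume j: "j \<in> multiplicities N k s"
    have "j i \<le> k" if "i \<in> {1..N}" for i
      using j member_le_sum[of i "{1..N}" j] that by (auto simp: multiplicities_def)
    then show "j \<in> {1..N} \<rightarrow>\<^sub>E {..k}"
      using j by (auto simp: multiplicities_def PiE_iff)
  qed
qed (auto intro: finite_PiE)

lemma jump_sum_cdf_0: "jump_sum_cdf b N 0 s = 1"
proof -
  have "multiplicities N 0 s = {\<lambda>i\<in>{1..N}. 0}"
    by (auto simp: multiplicities_def PiE_iff extensional_def fun_eq_iff)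
  then show ?thesis by (simp add: jump_sum_cdf_def)
qed

lemma jump_sum_cdf_eq_0:
  assumes "s < k"
  shows "jump_sum_cdf b N k s = 0"
proof -
  have le: "(\<Sum>i=1..N. j i) \<le> (\<Sum>i=1..N. i * j i)" for j
    by (rule sum_mono) auto
  have "j \<notin> multiplicities N k s" for j
    using le[of j] assms unfolding multiplicities_def by auto
  then have "multiplicities N k s = {}" by blast
  then show ?thesis by (simp add: jump_sum_cdf_def)
qed

text \<open>
  Condition on the size \<open>i\<close> of one jump. On the level of multinomial coefficients, the factor \<open>k + 1\<close> of
  \<open>(k + 1)!\<close> is the sum of the multiplicities; distributing over it and lowering \<open>j i\<close> by one maps the
  vectors that contain \<open>i\<close> bijectively to those for \<open>k\<close> jumps and level \<open>s - i\<close>.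
\<close>

lemma jump_sum_cdf_Suc:
  assumes "s \<le> N"
  shows "jump_sum_cdf b N (Suc k) s = (\<Sum>i=1..s. b i * jump_sum_cdf b N k (s - i))"
proof -
  let ?I = "{1..N}"
  let ?w = "\<lambda>j. (\<Prod>i=1..N. b i ^ j i) / (\<Prod>i=1..N. fact (j i))"
  let ?A = "\<lambda>i. {j \<in> multiplicities N (Suc k) s. j i > 0}"
  have fin: "finite (multiplicities N k s)" for k s by (rule finite_multiplicities)
  have split: "fact (Suc k) * ?w j = (\<Sum>i\<in>?I. fact k * (real (j i) * ?w j))"
    if "j \<in> multiplicities N (Suc k) s" for j
  proof -
    have "(\<Sum>i\<in>?I. real (j i)) = real (Suc k)"
      using that by (auto simp: multiplicities_def simp flip: of_nat_sum)
    then have "(\<Sum>i\<in>?I. fact k * (real (j i) * v)) = fact k * (real (Suc k) * v)" for v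
      by (metis (mono_tags, lifting) sum.cong sum_distrib_left sum_distrib_right)
    from this[of "?w j"] show ?thesis by (simp add: algebra_simps)
  qed
  have "jump_sum_cdf b N (Suc k) s = (\<Sum>j\<in>multiplicities N (Suc k) s. fact (Suc k) * ?w j)"
    by (simp add: jump_sum_cdf_def)
  also have "\<dots> = (\<Sum>j\<in>multiplicities N (Suc k) s. \<Sum>i\<in>?I. fact k * (real (j i) * ?w j))"
    by (rule sum.cong[OF refl split])
  also have "\<dots> = (\<Sum>i\<in>?I. \<Sum>j\<in>multiplicities N (Suc k) s. fact k * (real (j i) * ?w j))"
    by (rule sum.swap)
  also have "\<dots> = (\<Sum>i\<in>?I. \<Sum>j\<in>?A i. fact k * (real (j i) * ?w j))"
    by (intro sum.cong[OF refl] sum.mono_neutral_right fin) auto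
  also have "\<dots> = (\<Sum>i\<in>?I. if i \<le> s then b i * jump_sum_cdf b N k (s - i) else 0)"
  proof (rule sum.cong[OF refl])
    fix i assume i: "i \<in> ?I"
    have upd: "(\<Sum>l\<in>?I. l * (j(i := c)) l) + i * j i = (\<Sum>l\<in>?I. l * j l) + i * c"
      "(\<Sum>l\<in>?I. (j(i := c)) l) + j i = (\<Sum>l\<in>?I. j l) + c" for j :: "nat \<Rightarrow> nat" and c
    proof -
      have "(\<Sum>l\<in>?I. l * (j(i := c)) l) = i * c + (\<Sum>l\<in>?I - {i}. l * j l)"
        using i by (subst sum.remove[of _ i]) (auto intro!: sum.cong)
      moreover have "(\<Sum>l\<in>?I. l * j l) = i * j i + (\<Sum>l\<in>?I - {i}. l * j l)"
        using i by (subst sum.remove[of _ i]) auto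
      ultimately show "(\<Sum>l\<in>?I. l * (j(i := c)) l) + i * j i = (\<Sum>l\<in>?I. l * j l) + i * c"
        by simp
      have "(\<Sum>l\<in>?I. (j(i := c)) l) = c + (\<Sum>l\<in>?I - {i}. j l)"
        using i by (subst sum.remove[of _ i]) (auto intro!: sum.cong)
      moreover have "(\<Sum>l\<in>?I. j l) = j i + (\<Sum>l\<in>?I - {i}. j l)"
        using i by (subst sum.remove[of _ i]) auto
      ultimately show "(\<Sum>l\<in>?I. (j(i := c)) l) + j i = (\<Sum>l\<in>?I. j l) + c"
        by simp
    qed
    have w: "real (Suc (j i)) * ?w (j(i := Suc (j i))) = b i * ?w j" for j
    proof -
      define P Q v where "P = (\<Prod>l\<in>?I - {i}. b l ^ j l)"
        and "Q = (\<Prod>l\<in>?I - {i}. fact (j l) :: real)" and "v = real (Suc (j i))"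
      have "(\<Prod>l\<in>?I. b l ^ (j(i := Suc (j i))) l) = b i ^ Suc (j i) * P"
        unfolding P_def using i by (subst prod.remove[of _ i]) (auto intro!: prod.cong)
      moreover have "(\<Prod>l\<in>?I. b l ^ j l) = b i ^ j i * P"
        unfolding P_def using i by (subst prod.remove[of _ i]) auto
      moreover have "(\<Prod>l\<in>?I. fact ((j(i := Suc (j i))) l)) = (v * fact (j i)) * Q"
        unfolding Q_def v_def using i by (subst prod.remove[of _ i]) (auto intro!: prod.cong)
      moreover have "(\<Prod>l\<in>?I. fact (j l)) = fact (j i) * Q"
        unfolding Q_def using i by (subst prod.remove[of _ i]) auto
      ultimately have "v * ?w (j(i := Suc (j i))) =
          v * (b i ^ Suc (j i) * P / ((v * fact (j i)) * Q))" "b i * ?w j = b i * (b i ^ j i * P / (fact (j i) * Q))"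
        by (simp_all only:)
      moreover have "v \<noteq> 0" by (simp add: v_def)
      ultimately have "v * ?w (j(i := Suc (j i))) = b i * ?w j" by simp
      then show ?thesis unfolding v_def .
    qed
    show "(\<Sum>j\<in>?A i. fact k * (real (j i) * ?w j)) =
        (if i \<le> s then b i * jump_sum_cdf b N k (s - i) else 0)"
    proof (cases "i \<le> s")
      case True
      have "(\<Sum>j\<in>?A i. fact k * (real (j i) * ?w j)) =
          (\<Sum>j\<in>multiplicities N k (s - i). fact k * (b i * ?w j))"
      proof (rule sum.reindex_bij_witness
          [where i = "\<lambda>j. j(i := Suc (j i))" and j = "\<lambda>j. j(i := j i - 1)"])
        fix j assume j: "j \<in> ?A i"
        then obtain c where c: "j i = Suc c" by (auto simp: gr0_conv_Suc)
        then show restore: "(j(i := j i - 1))(i := Suc ((j(i := j i - 1)) i)) = j"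
          by (simp add: fun_eq_iff)
        have "(\<Sum>l\<in>?I. (j(i := c)) l) = k" "(\<Sum>l\<in>?I. l * (j(i := c)) l) \<le> s - i"
          using j c True upd[of j c] unfolding multiplicities_def
          by (simp_all add: le_diff_conv2)
        moreover have "j(i := c) \<in> ?I \<rightarrow>\<^sub>E UNIV"
          using j i unfolding multiplicities_def PiE_iff extensional_def by simp
        ultimately show "j(i := j i - 1) \<in> multiplicities N k (s - i)"
          unfolding multiplicities_def c by simp
        show "fact k * (b i * ?w (j(i := j i - 1))) = fact k * (real (j i) * ?w j)"
          using w[of "j(i := j i - 1)"] unfolding restore by (simp add: c)
      next
        fix j assume j: "j \<in> multiplicities N k (s - i)"
        show "(j(i := Suc (j i)))(i := (j(i := Suc (j i))) i - 1) = j"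
          by (simp add: fun_eq_iff)
        have "(\<Sum>l\<in>?I. (j(i := Suc (j i))) l) = Suc k"
          "(\<Sum>l\<in>?I. l * (j(i := Suc (j i))) l) \<le> s"
          using j True upd[of j "Suc (j i)"] unfolding multiplicities_def
          by (simp_all add: le_diff_conv2)
        moreover have "j(i := Suc (j i)) \<in> ?I \<rightarrow>\<^sub>E UNIV"
          using j i unfolding multiplicities_def PiE_iff extensional_def by simp
        ultimately show "j(i := Suc (j i)) \<in> ?A i"
          unfolding multiplicities_def by simp
      qed
      then show ?thesis
        using True by (simp add: jump_sum_cdf_def sum_distrib_left mult_ac)
    next
      case False
      have "j i = 0" if "j \<in> multiplicities N (Suc k) s" for j
      proof (rule ccontr)
        assume "j i \<noteq> 0"
        then have "i \<le> i * j i" by simp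
        also have "\<dots> \<le> (\<Sum>l\<in>?I. l * j l)"
          using i by (intro member_le_sum) auto
        finally show False using that False by (auto simp: multiplicities_def)
      qed
      then have empty: "?A i = {}" by auto
      show ?thesis unfolding empty using False by simp
    qed
  qed
  also have "\<dots> = (\<Sum>i\<in>{i\<in>?I. i \<le> s}. b i * jump_sum_cdf b N k (s - i))"
    by (rule sum.inter_filter[symmetric]) simp
  also have "{i\<in>?I. i \<le> s} = {1..s}" using assms by auto
  finally show ?thesis .
qed

lemma jump_sum_cdf_bounds:
  assumes "\<And>i. 0 \<le> b i" "(\<Sum>i=1..N. b i) \<le> 1" "s \<le> N"
  shows "jump_sum_cdf b N k s \<in> {0..1}"
  using assms(3)
proof (induction k arbitrary: s)
  case 0
  show ?case by (simp add: jump_sum_cdf_0)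
next
  case (Suc k)
  have IH: "0 \<le> jump_sum_cdf b N k (s - i)" "jump_sum_cdf b N k (s - i) \<le> 1" for i
    using Suc.IH[of "s - i"] Suc.prems by auto
  have "(\<Sum>i=1..s. b i * jump_sum_cdf b N k (s - i)) \<le> (\<Sum>i=1..s. b i)"
    by (intro sum_mono mult_right_le_one_le IH assms)
  also have "\<dots> \<le> (\<Sum>i=1..N. b i)"
    using Suc.prems assms(1) by (intro sum_mono2) auto
  finally show ?case
    using assms(1,2) IH Suc.prems by (auto simp: jump_sum_cdf_Suc intro!: sum_nonneg)
qed

section \<open>Binomial mixtures\<close>

text \<open>
  The success probability is \<open>1 - F\<close>; the failure probability \<open>F\<close> is the parameter because it will be the
  distribution function of a cycle maximum.
\<close>

definition binomial_prob :: "nat \<Rightarrow> real \<Rightarrow> nat \<Rightarrow> real" where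
  "binomial_prob m F k = real (m choose k) * (1 - F) ^ k * F ^ (m - k)"

lemma binomial_mixture_Suc:
  fixes u :: "nat \<Rightarrow> real"
  shows "(\<Sum>k\<le>Suc m. binomial_prob (Suc m) F k * u k) =
    F * (\<Sum>k\<le>m. binomial_prob m F k * u k) + (1 - F) * (\<Sum>k\<le>m. binomial_prob m F k * u (Suc k))"
proof -
  have "(\<Sum>k\<le>Suc m. binomial_prob (Suc m) F k * u k) = F ^ Suc m * u 0 +
      (\<Sum>k\<le>m. binomial_prob (Suc m) F (Suc k) * u (Suc k))"
    by (subst sum.atMost_Suc_shift) (simp add: binomial_prob_def)
  also have "(\<Sum>k\<le>m. binomial_prob (Suc m) F (Suc k) * u (Suc k)) =
      (\<Sum>k\<le>m. (1 - F) * (binomial_prob m F k * u (Suc k))) +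
      (\<Sum>k\<le>m. real (m choose Suc k) * (1 - F) ^ Suc k * F ^ (m - k) * u (Suc k))"
    unfolding sum.distrib[symmetric] by (simp add: binomial_prob_def algebra_simps)
  also have "(\<Sum>k\<le>m. real (m choose Suc k) * (1 - F) ^ Suc k * F ^ (m - k) * u (Suc k)) =
      (\<Sum>k<m. F * (binomial_prob m F (Suc k) * u (Suc k)))"
    by (rule sum.mono_neutral_cong_right)
       (auto simp: binomial_prob_def Suc_diff_Suc simp flip: power_Suc)
  also have "F ^ Suc m * u 0 + ((\<Sum>k\<le>m. (1 - F) * (binomial_prob m F k * u (Suc k))) +
      (\<Sum>k<m. F * (binomial_prob m F (Suc k) * u (Suc k)))) =
      F * (binomial_prob m F 0 * u 0 + (\<Sum>k<m. binomial_prob m F (Suc k) * u (Suc k))) +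
      (1 - F) * (\<Sum>k\<le>m. binomial_prob m F k * u (Suc k))"
    by (simp add: binomial_prob_def algebra_simps sum_distrib_left sum_subtractf)
  also have "binomial_prob m F 0 * u 0 + (\<Sum>k<m. binomial_prob m F (Suc k) * u (Suc k)) =
      (\<Sum>k\<le>m. binomial_prob m F k * u k)"
    by (simp add: sum.atMost_shift)
  finally show ?thesis .
qed

text \<open>
  The hypotheses are the recursion, obtained by conditioning on the last summand, for the distribution
  function of a sum of \<open>m\<close> independent summands that vanish with probability \<open>F\<close> and have size \<open>i\<close> with
  probability \<open>(1 - F) * b i\<close>. The conclusion sorts by the number \<open>k\<close> of nonzero summands, which is
  binomial; \<open>k \<le> s\<close> suffices, as each of them is at least 1.
\<close>

lemma binomial_mixture_eq:
  fixes a :: "nat \<Rightarrow> nat \<Rightarrow> real"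
  assumes a0: "\<And>s. s \<le> N \<Longrightarrow> a 0 s = 1"
    and aS: "\<And>m s. s \<le> N \<Longrightarrow>
          a (Suc m) s = F * a m s + (\<Sum>i=1..s. (1 - F) * b i * a m (s - i))"
    and "s \<le> N"
  shows "a m s = (\<Sum>k\<le>s. binomial_prob m F k * jump_sum_cdf b N k s)"
proof -
  have "a m s = (\<Sum>k\<le>m. binomial_prob m F k * jump_sum_cdf b N k s)"
    using \<open>s \<le> N\<close>
  proof (induction m arbitrary: s)
    case 0
    then show ?case by (simp add: a0 binomial_prob_def jump_sum_cdf_0)
  next
    case (Suc m)
    have "(\<Sum>i=1..s. (1 - F) * b i * a m (s - i)) =
        (\<Sum>i=1..s. \<Sum>k\<le>m. (1 - F) * (binomial_prob m F k * (b i * jump_sum_cdf b N k (s - i))))"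
      using Suc by (intro sum.cong refl) (simp add: sum_distrib_left mult_ac)
    also have "\<dots> = (1 - F) * (\<Sum>k\<le>m. binomial_prob m F k * jump_sum_cdf b N (Suc k) s)"
      using Suc.prems by (subst sum.swap) (simp add: sum_distrib_left jump_sum_cdf_Suc)
    finally show ?case
      using Suc by (simp add: aS binomial_mixture_Suc del: sum.atMost_Suc)
  qed
  also have "\<dots> = (\<Sum>k\<le>max m s. binomial_prob m F k * jump_sum_cdf b N k s)"
    by (rule sum.mono_neutral_left) (auto simp: binomial_prob_def)
  also have "\<dots> = (\<Sum>k\<le>s. binomial_prob m F k * jump_sum_cdf b N k s)"
    by (rule sum.mono_neutral_right) (auto simp: jump_sum_cdf_eq_0)
  finally show ?thesis .
qed

section \<open>Uniform Poisson approximation\<close>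

definition poisson_prob :: "nat \<Rightarrow> real \<Rightarrow> real" where
  "poisson_prob k z = exp (- z) * z ^ k / fact k"

lemma poisson_prob_bounds: "0 \<le> z \<Longrightarrow> poisson_prob k z \<in> {0..1}"
proof -
  assume z: "0 \<le> z"
  have "(\<Sum>n\<in>{k}. z ^ n /\<^sub>R fact n) \<le> exp z"
    unfolding exp_def using z by (intro sum_le_suminf summable_exp_generic) auto
  then show ?thesis
    using z by (auto simp: poisson_prob_def exp_minus field_simps)
qed

text \<open>
  Exponential decay with constants that do not depend on \<open>z\<close>, which serves the case of \<open>F\<close>
  bounded away from 1 in \<open>binomial_prob_poisson_limit\<close>.
\<close>

lemma poisson_prob_half: "0 \<le> z \<Longrightarrow> poisson_prob k z \<le> 2 ^ k * exp (- (z / 2))"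
proof -
  assume "0 \<le> z"
  then have "poisson_prob k (z / 2) * (2 ^ k * exp (- (z / 2))) \<le> 1 * (2 ^ k * exp (- (z / 2)))"
    by (intro mult_right_mono) (use poisson_prob_bounds[of "z / 2" k] in auto)
  moreover have "exp (- z) = exp (- (z / 2)) * exp (- (z / 2))"
    by (simp flip: exp_add)
  ultimately show ?thesis
    by (simp add: poisson_prob_def power_divide mult_ac)
qed

lemma poisson_prob_deriv:
  "z * (exp (- z) * (real k * z ^ (k - 1)) / fact k - exp (- z) * z ^ k / fact k) =
   real k * poisson_prob k z - real (Suc k) * poisson_prob (Suc k) z"
  by (cases k) (simp_all add: poisson_prob_def field_simps del: of_nat_Suc)

text \<open>
  A relative error \<open>c\<close> in the parameter costs \<open>O(c)\<close> uniformly in the parameter: by the mean value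
  theorem the difference is at most \<open>2 * c * \<bar>z * p\<^sub>k' z\<bar>\<close> for some intermediate \<open>z\<close>, where \<open>p\<^sub>k\<close> is the
  Poisson probability of \<open>k\<close>, and \<open>z * p\<^sub>k' z\<close> is the bounded function \<open>k * p\<^sub>k z - (k + 1) * p\<^sub>k\<^sub>+\<^sub>1 z\<close>.
\<close>

lemma poisson_prob_rescale:
  assumes "0 \<le> y" "0 < t" "0 \<le> c" "c \<le> 1 / 2" "\<bar>m - t\<bar> \<le> c * t"
  shows "\<bar>poisson_prob k (m * y) - poisson_prob k (t * y)\<bar> \<le> 2 * c * real (2 * k + 1)"
proof (cases "m * y = t * y")
  case True
  then have "\<bar>poisson_prob k (m * y) - poisson_prob k (t * y)\<bar> = 0" unfolding True by simp
  then show ?thesis using assms by (metis mult_nonneg_nonneg of_nat_0_le_iff zero_le_numeral)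
next
  case False
  let ?D = "\<lambda>z::real. exp (- z) * (real k * z ^ (k - 1)) / fact k - exp (- z) * z ^ k / fact k"
  have D: "(poisson_prob k has_real_derivative ?D z) (at z)" for z
    unfolding poisson_prob_def
    by (auto intro!: derivative_eq_intros simp: field_simps)
  have ct: "c * t \<le> t / 2" using assms by (simp add: field_simps)
  obtain z where z: "min (m * y) (t * y) \<le> z"
    "\<bar>poisson_prob k (m * y) - poisson_prob k (t * y)\<bar> = \<bar>m * y - t * y\<bar> * \<bar>?D z\<bar>"
  proof (cases "m * y < t * y")
    case True
    obtain z where z: "m * y < z"
      "poisson_prob k (t * y) - poisson_prob k (m * y) = (t * y - m * y) * ?D z"
      using MVT2[OF True, of "poisson_prob k" ?D] D by blast
    show ?thesis
    proof (rule that)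
      show "min (m * y) (t * y) \<le> z" using z(1) by simp
      show "\<bar>poisson_prob k (m * y) - poisson_prob k (t * y)\<bar> = \<bar>m * y - t * y\<bar> * \<bar>?D z\<bar>"
        unfolding abs_mult[symmetric] abs_minus_commute[of "poisson_prob k (m * y)"] z(2)
        by (simp only: abs_mult abs_minus_commute)
    qed
  next
    case F: False
    with False have less: "t * y < m * y" by (metis linorder_neqE)
    obtain z where z: "t * y < z"
      "poisson_prob k (m * y) - poisson_prob k (t * y) = (m * y - t * y) * ?D z"
      using MVT2[OF less, of "poisson_prob k" ?D] D by blast
    show ?thesis
    proof (rule that)
      show "min (m * y) (t * y) \<le> z" using z(1) by simp
      show "\<bar>poisson_prob k (m * y) - poisson_prob k (t * y)\<bar> = \<bar>m * y - t * y\<bar> * \<bar>?D z\<bar>"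
        unfolding z(2) by (rule abs_mult)
    qed
  qed
  have "t * y / 2 \<le> min (m * y) (t * y)"
  proof -
    have "t / 2 \<le> m" using assms(5) ct by linarith
    then have "t / 2 * y \<le> m * y" by (rule mult_right_mono) fact
    moreover have "t / 2 * y \<le> t * y"
      by (rule mult_right_mono) (use assms in auto)
    ultimately show ?thesis by simp
  qed
  then have zl: "t * y / 2 \<le> z" using z(1) by (rule order_trans)
  then have z0: "0 \<le> z" using assms 
    by (meson divide_nonneg_pos less_imp_le mult_nonneg_nonneg order_trans zero_less_numeral)
  have "\<bar>m * y - t * y\<bar> = \<bar>m - t\<bar> * y"
    using assms by (simp flip: left_diff_distrib add: abs_mult)
  also have "\<dots> \<le> (c * t) * y" using assms by (intro mult_right_mono)
  also have "\<dots> \<le> 2 * c * z" using mult_left_mono[OF zl, of "2 * c"] assms by simp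
  finally have "\<bar>m * y - t * y\<bar> * \<bar>?D z\<bar> \<le> 2 * c * z * \<bar>?D z\<bar>"
    by (rule mult_right_mono) simp
  also have "\<dots> = 2 * c * \<bar>z * ?D z\<bar>" using z0 by (simp add: abs_mult)
  also have "\<dots> \<le> 2 * c * real (2 * k + 1)"
  proof (rule mult_left_mono)
    have "real k * poisson_prob k z \<le> real k" "real (Suc k) * poisson_prob (Suc k) z \<le> real (Suc k)"
      "0 \<le> real k * poisson_prob k z" "0 \<le> real (Suc k) * poisson_prob (Suc k) z"
      using poisson_prob_bounds[OF z0] by (auto simp: mult_left_le simp del: of_nat_Suc)
    then show "\<bar>z * ?D z\<bar> \<le> real (2 * k + 1)"
      unfolding poisson_prob_deriv by linarith
  qed (use assms in simp)
  finally show ?thesis using z(2) by simp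
qed

text \<open>
  The Poisson parameter is \<open>- m * ln F\<close>, not \<open>m * (1 - F)\<close>, so that both laws give the same probability
  \<open>F ^ m\<close> to 0. With \<open>y = - ln F\<close> the two bounds follow from \<open>F * y \<le> 1 - F \<le> y\<close> and
  \<open>(m - k) ^ k \<le> k! * (m choose k) \<le> m ^ k\<close>. The errors are factors, and they tend to 1 as \<open>F\<close> tends to 1
  and \<open>m\<close> to infinity, no matter how \<open>m * y\<close> behaves.
\<close>

lemma binomial_prob_near_1:
  assumes "0 < F" "F \<le> 1" "k \<le> m" "0 < m"
  defines "w \<equiv> poisson_prob k (- real m * ln F)"
  shows "binomial_prob m F k \<le> w / F ^ k"
    and "(1 - real k / real m) ^ k * F ^ k * w \<le> binomial_prob m F k"
proof -
  define y where "y = - ln F"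
  have y: "1 - F \<le> y" "0 \<le> y" "F * y \<le> 1 - F"
  proof -
    show "1 - F \<le> y" using ln_le_minus_one[of F] assms by (simp add: y_def)
    then show "0 \<le> y" using assms by simp
    have "ln (1 / F) \<le> 1 / F - 1" using assms by (intro ln_le_minus_one) simp
    then have "F * y \<le> F * (1 / F - 1)"
      using assms by (intro mult_left_mono) (auto simp: y_def ln_div)
    also have "\<dots> = 1 - F" using assms by (simp add: right_diff_distrib)
    finally show "F * y \<le> 1 - F" .
  qed
  have w: "w = F ^ m * (real m * y) ^ k / fact k"
    using assms by (simp add: w_def poisson_prob_def y_def exp_of_nat_mult)
  have Fm: "F ^ m = F ^ (m - k) * F ^ k" using assms by (simp flip: power_add)
  have up: "real (m choose k) \<le> real m ^ k / fact k"
    using of_nat_mono[OF binomial_fact_pow[of m k], where ?'a = real]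
    by (simp add: pos_le_divide_eq)
  have lo: "(real m - real k) ^ k / fact k \<le> real (m choose k)"
  proof -
    have "(\<Prod>i<k. real m - real k) \<le> (\<Prod>i = 0..<k. real m - real i)"
      unfolding lessThan_atLeast0 using assms by (intro prod_mono) auto
    then show ?thesis
      by (simp add: binomial_gbinomial gbinomial_prod_rev divide_right_mono)
  qed
  have "binomial_prob m F k \<le> (real m ^ k / fact k) * y ^ k * F ^ (m - k)"
    unfolding binomial_prob_def using y assms up
    by (intro mult_right_mono mult_mono power_mono) auto
  also have "\<dots> = w / F ^ k"
    using assms(1) by (simp add: w Fm power_mult_distrib)
  finally show "binomial_prob m F k \<le> w / F ^ k" .
  have "(1 - real k / real m) ^ k * F ^ k * w =
      ((1 - real k / real m) * real m) ^ k / fact k * (F * y) ^ k * F ^ m"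
    by (simp add: w power_mult_distrib)
  also have "(1 - real k / real m) * real m = real m - real k"
    using assms by (simp add: field_simps)
  also have "(real m - real k) ^ k / fact k * (F * y) ^ k * F ^ m \<le>
      real (m choose k) * (1 - F) ^ k * F ^ (m - k)"
    using y assms lo
    by (intro mult_mono power_mono mult_nonneg_nonneg power_decreasing) (auto intro!: mult_nonneg_nonneg)
  finally show "(1 - real k / real m) ^ k * F ^ k * w \<le> binomial_prob m F k"
    by (simp add: binomial_prob_def)
qed


text \<open>
  The Poisson probability of \<open>k\<close> for the parameter \<open>- t * ln F\<close>, written with \<open>powr\<close> so that it becomes 0
  for \<open>F = 0\<close>, the limit as \<open>F\<close> decreases to 0 if \<open>t > 0\<close>.
\<close>

definition poisson_weight :: "nat \<Rightarrow> real \<Rightarrow> real \<Rightarrow> real" where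
  "poisson_weight k t F = F powr t * (- ln (F powr t)) ^ k / fact k"

lemma poisson_weight_0 [simp]: "poisson_weight k t 0 = 0"
  by (simp add: poisson_weight_def)

lemma poisson_weight_eq: "0 < F \<Longrightarrow> poisson_weight k t F = poisson_prob k (t * - ln F)"
  by (simp add: poisson_weight_def poisson_prob_def powr_def ln_powr)

lemma poisson_weight_bounds:
  assumes "F \<in> {0..1}" "0 \<le> t"
  shows "poisson_weight k t F \<in> {0..1}"
proof (cases "F = 0")
  case False
  then have "0 \<le> t * - ln F" using assms by (intro mult_nonneg_nonneg) auto
  then show ?thesis using False assms poisson_prob_bounds by (simp add: poisson_weight_eq)
qed simp

text \<open>
  Uniformity in \<open>F\<close> comes from splitting at some \<open>F0 < 1\<close> close to 1. Above \<open>F0\<close> the two quantities have a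
  ratio close to 1 and are bounded; below \<open>F0\<close> both are exponentially small in \<open>m\<close>.
\<close>

lemma binomial_prob_poisson_limit:
  assumes "0 < \<epsilon>"
  shows "\<forall>\<^sub>F m in sequentially. \<forall>F\<in>{0..1}.
           \<bar>binomial_prob m F k - poisson_weight k (real m) F\<bar> \<le> \<epsilon>"
proof -
  have "\<forall>\<^sub>F F in at_left (1::real). 1 / F ^ k - 1 < \<epsilon> \<and> 1 - F ^ k < \<epsilon> / 2 \<and> 0 < F \<and> F < 1"
  proof (intro eventually_conj)
    have "((\<lambda>F::real. 1 / F ^ k - 1) \<longlongrightarrow> 1 / 1 ^ k - 1) (at_left 1)"
      by (intro tendsto_intros) auto
    then show "\<forall>\<^sub>F F in at_left (1::real). 1 / F ^ k - 1 < \<epsilon>"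
      by (rule order_tendstoD) (use assms in simp)
    have "((\<lambda>F::real. 1 - F ^ k) \<longlongrightarrow> 1 - 1 ^ k) (at_left 1)"
      by (intro tendsto_intros)
    then show "\<forall>\<^sub>F F in at_left (1::real). 1 - F ^ k < \<epsilon> / 2"
      by (rule order_tendstoD) (use assms in simp)
    have "\<forall>\<^sub>F F in at_left (1::real). F \<in> {0<..<1}"
      by (rule eventually_at_left_real) simp
    then show "\<forall>\<^sub>F F in at_left (1::real). 0 < F" "\<forall>\<^sub>F F in at_left (1::real). F < 1"
      by (auto elim: eventually_mono)
  qed
  then obtain F0 :: real where F0: "1 / F0 ^ k - 1 < \<epsilon>" "1 - F0 ^ k < \<epsilon> / 2" "0 < F0" "F0 < 1"
    using eventually_happens[of _ "at_left (1::real)"] by (auto simp: trivial_limit_at_left_real)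
  define y0 where "y0 = - ln F0"
  have y0: "0 < y0" using F0 by (simp add: y0_def)
  have "(\<lambda>m. real m ^ k * F0 ^ (m - k)) \<longlonglongrightarrow> 0"
    using F0(3,4) by real_asymp
  then have ev1: "\<forall>\<^sub>F m in sequentially. real m ^ k * F0 ^ (m - k) < \<epsilon>"
    by (rule order_tendstoD) fact
  have "(\<lambda>m. 2 ^ k * exp (- (real m * y0 / 2))) \<longlonglongrightarrow> 0"
    using y0 by real_asymp
  then have ev2: "\<forall>\<^sub>F m in sequentially. 2 ^ k * exp (- (real m * y0 / 2)) < \<epsilon>"
    by (rule order_tendstoD) fact
  have "(\<lambda>m. 1 - (1 - real k / real m) ^ k) \<longlonglongrightarrow> 1 - (1 - 0) ^ k"
    by (intro tendsto_intros lim_const_over_n)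
  then have ev3: "\<forall>\<^sub>F m in sequentially. 1 - (1 - real k / real m) ^ k < \<epsilon> / 2"
    by (rule order_tendstoD) (use assms in simp)
  show ?thesis
    using ev1 ev2 ev3 eventually_gt_at_top[of k]
  proof (eventually_elim, intro ballI)
    fix m and F :: real
    assume m: "real m ^ k * F0 ^ (m - k) < \<epsilon>" "2 ^ k * exp (- (real m * y0 / 2)) < \<epsilon>"
      "1 - (1 - real k / real m) ^ k < \<epsilon> / 2" "k < m" and F: "F \<in> {0..1}"
    let ?b = "binomial_prob m F k" and ?w = "poisson_weight k (real m) F"
    have b0: "0 \<le> ?b" using F by (simp add: binomial_prob_def)
    have w: "0 \<le> ?w" "?w \<le> 1" using poisson_weight_bounds[of F "real m" k] F by auto
    show "\<bar>?b - ?w\<bar> \<le> \<epsilon>"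
    proof (cases "F0 \<le> F")
      case True
      have we: "?w = poisson_prob k (- real m * ln F)"
        using True F0 by (simp add: poisson_weight_eq)
      note near = binomial_prob_near_1[of F k m, folded we]
      have Fk: "F0 ^ k \<le> F ^ k" "F ^ k \<le> 1" using True F0 F by (auto intro: power_mono power_le_one)
      have "?b - ?w \<le> ?w * (1 / F ^ k - 1)"
        using near(1) True F0 F m by (simp add: algebra_simps)
      also have "\<dots> \<le> 1 * (1 / F0 ^ k - 1)"
        using w Fk F0 True by (intro mult_mono) (auto intro!: divide_left_mono)
      finally have 1: "?b - ?w \<le> \<epsilon>" using F0 by simp
      define a where "a = (1 - real k / real m) ^ k"
      have a: "0 \<le> a" "a \<le> 1"
        using m by (auto simp: a_def intro!: power_le_one)
      have "?w - ?b \<le> ?w * (1 - a * F ^ k)"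
        using near(2) True F0 F m by (simp add: algebra_simps a_def)
      also have "\<dots> \<le> 1 * (1 - a * F ^ k)"
        using w a Fk F by (intro mult_right_mono) (auto simp: mult_le_one)
      also have "\<dots> \<le> (1 - a) + (1 - F ^ k)"
        using mult_nonneg_nonneg[of "1 - a" "1 - F ^ k"] a Fk by (simp add: algebra_simps)
      finally have "?w - ?b \<le> \<epsilon>" using F0 m Fk by (simp add: a_def)
      with 1 show ?thesis by simp
    next
      case False
      have "real (m choose k) \<le> real m ^ k"
        using binomial_le_pow[of k m] m by (simp flip: of_nat_power)
      then have "?b \<le> real m ^ k * 1 ^ k * F0 ^ (m - k)"
        unfolding binomial_prob_def using False F by (intro mult_mono power_mono) simp_all
      then have 1: "?b \<le> \<epsilon>" using m by simp
      have "?w \<le> \<epsilon>"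
      proof (cases "F = 0")
        case True
        then show ?thesis using assms by simp
      next
        case nz: False
        have y: "y0 \<le> - ln F" using nz False F by (simp add: y0_def)
        then have "0 \<le> real m * - ln F" using y0 by (intro mult_nonneg_nonneg) auto
        then have "?w \<le> 2 ^ k * exp (- (real m * - ln F / 2))"
          using poisson_prob_half[of "real m * - ln F" k] nz F by (simp add: poisson_weight_eq)
        also have "\<dots> \<le> 2 ^ k * exp (- (real m * y0 / 2))"
          using mult_left_mono[OF y, of "real m"] by simp
        finally show ?thesis using m by simp
      qed
      with 1 b0 w show ?thesis by simp
    qed
  qed
qed

text \<open>
  The time \<open>t\<close> need not be the number of trials: it may differ from it by a small relative error. This slack
  absorbs the fluctuation of the number of cycles up to a given time.
\<close>

lemma binomial_prob_uniform_approx: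
  assumes "0 < \<epsilon>"
  shows "\<exists>c>0. \<exists>T. \<forall>t\<ge>T. \<forall>m. \<bar>real m - t\<bar> \<le> c * t \<longrightarrow>
           (\<forall>F\<in>{0..1}. \<bar>binomial_prob m F k - poisson_weight k t F\<bar> \<le> \<epsilon>)"
proof -
  obtain m0 where m0: "\<And>m F. m0 \<le> m \<Longrightarrow> F \<in> {0..1} \<Longrightarrow>
      \<bar>binomial_prob m F k - poisson_weight k (real m) F\<bar> \<le> \<epsilon> / 2"
    using binomial_prob_poisson_limit[of "\<epsilon> / 2" k] assms
    unfolding eventually_sequentially by (meson half_gt_zero)
  define K where "K = real (2 * k + 1)"
  have K: "1 \<le> K" by (simp add: K_def)
  define c where "c = min (1 / 2) (\<epsilon> / (4 * K))"
  have c: "0 < c" "c \<le> 1 / 2" "2 * c * K \<le> \<epsilon> / 2"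
  proof -
    show "0 < c" "c \<le> 1 / 2" using assms K by (auto simp: c_def)
    have "2 * c * K \<le> 2 * (\<epsilon> / (4 * K)) * K"
      using K by (intro mult_right_mono mult_left_mono) (auto simp: c_def)
    then show "2 * c * K \<le> \<epsilon> / 2" using K by simp
  qed
  show ?thesis
  proof (rule exI[of _ c], rule conjI[OF c(1)], rule exI[of _ "max 1 (2 * real m0)"],
      intro allI impI ballI)
    fix t and m :: nat and F :: real
    assume t: "max 1 (2 * real m0) \<le> t" and m: "\<bar>real m - t\<bar> \<le> c * t" and F: "F \<in> {0..1}"
    have "c * t \<le> t / 2" using c t by (simp add: field_simps)
    then have "t / 2 \<le> real m" using m by linarith
    then have "m0 \<le> m" using t by simp
    then have 1: "\<bar>binomial_prob m F k - poisson_weight k (real m) F\<bar> \<le> \<epsilon> / 2"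
      using m0 F by blast
    have "\<bar>poisson_weight k (real m) F - poisson_weight k t F\<bar> \<le> \<epsilon> / 2"
    proof (cases "F = 0")
      case True
      then show ?thesis using assms by simp
    next
      case False
      then have "\<bar>poisson_weight k (real m) F - poisson_weight k t F\<bar> \<le> 2 * c * K"
        using poisson_prob_rescale[of "- ln F" t c "real m" k] F t m c
        by (simp add: poisson_weight_eq K_def)
      with c show ?thesis by linarith
    qed
    with 1 show "\<bar>binomial_prob m F k - poisson_weight k t F\<bar> \<le> \<epsilon>" by linarith
  qed
qed

lemma binomial_prob_uniform_approx_sum:
  "0 < \<epsilon> \<Longrightarrow> \<exists>c>0. \<exists>T. \<forall>t\<ge>T. \<forall>m. \<bar>real m - t\<bar> \<le> c * t \<longrightarrow>
     (\<forall>F\<in>{0..1}. (\<Sum>k\<le>s. \<bar>binomial_prob m F k - poisson_weight k t F\<bar>) \<le> \<epsilon>)"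
proof (induction s arbitrary: \<epsilon>)
  case 0
  have eq: "(\<Sum>k\<le>0. g k) = g 0" for g :: "nat \<Rightarrow> real" by simp
  show ?case unfolding eq by (rule binomial_prob_uniform_approx[OF 0])
next
  case (Suc s)
  obtain c1 T1 where 1: "0 < c1" "\<And>t m F. T1 \<le> t \<Longrightarrow> \<bar>real m - t\<bar> \<le> c1 * t \<Longrightarrow> F \<in> {0..1} \<Longrightarrow>
      (\<Sum>k\<le>s. \<bar>binomial_prob m F k - poisson_weight k t F\<bar>) \<le> \<epsilon> / 2"
    using Suc.IH[of "\<epsilon> / 2"] Suc.prems by (meson half_gt_zero)
  obtain c2 T2 where 2: "0 < c2" "\<And>t m F. T2 \<le> t \<Longrightarrow> \<bar>real m - t\<bar> \<le> c2 * t \<Longrightarrow> F \<in> {0..1} \<Longrightarrow>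
      \<bar>binomial_prob m F (Suc s) - poisson_weight (Suc s) t F\<bar> \<le> \<epsilon> / 2"
    using binomial_prob_uniform_approx[of "\<epsilon> / 2" "Suc s"] Suc.prems by (meson half_gt_zero)
  have c: "0 < min c1 c2" using 1(1) 2(1) by simp
  show ?case
  proof (rule exI[of _ "min c1 c2"], rule conjI[OF c],
      rule exI[of _ "max 0 (max T1 T2)"], intro allI impI ballI)
    fix t and m :: nat and F :: real
    assume t: "max 0 (max T1 T2) \<le> t" and m: "\<bar>real m - t\<bar> \<le> min c1 c2 * t" and F: "F \<in> {0..1}"
    have "min c1 c2 * t \<le> c1 * t" "min c1 c2 * t \<le> c2 * t"
      using t by (auto intro: mult_right_mono)
    with 1(2)[of t m F] 2(2)[of t m F] t m F
    show "(\<Sum>k\<le>Suc s. \<bar>binomial_prob m F k - poisson_weight k t F\<bar>) \<le> \<epsilon>"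
      by auto
  qed
qed

section \<open>The weak law of large numbers\<close>

text \<open>
  Only a first moment is available, so the variables are truncated at a level \<open>K\<close>. The truncated part is
  bounded and obeys Hoeffding's inequality; the rest has small mean for large \<open>K\<close> by dominated
  convergence, and Markov's inequality bounds its sum.
\<close>

lemma (in prob_space) weak_law_of_large_numbers:
  fixes Y :: "nat \<Rightarrow> 'a \<Rightarrow> real"
  assumes indep: "indep_vars (\<lambda>_. borel) Y UNIV"
    and ident: "\<And>n. distr M borel (Y n) = distr M borel (Y 0)"
    and int: "integrable M (Y 0)"
    and "0 < \<delta>"
  shows "(\<lambda>n. \<P>(\<omega> in M. \<delta> * real n \<le> \<bar>(\<Sum>k<n. Y k \<omega>) - real n * expectation (Y 0)\<bar>)) \<longlonglongrightarrow> 0"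
proof (rule LIMSEQ_I)
  fix \<epsilon> :: real assume "0 < \<epsilon>"
  have [measurable]: "random_variable borel (Y n)" for n
    using indep by (auto simp: indep_vars_def)
  define Z where "Z K y = (if \<bar>y\<bar> \<le> K then y else 0)" for K y :: real
  have [measurable]: "Z K \<in> borel_measurable borel" for K unfolding Z_def by measurable
  have Z_abs: "\<bar>Z K y\<bar> \<le> \<bar>y\<bar>" "\<bar>y - Z K y\<bar> \<le> \<bar>y\<bar>" for K y by (auto simp: Z_def)
  have lim: "(\<lambda>i. expectation (\<lambda>\<omega>. \<bar>Y 0 \<omega> - Z (real i) (Y 0 \<omega>)\<bar>)) \<longlonglongrightarrow> expectation (\<lambda>\<omega>. 0)"
  proof (rule integral_dominated_convergence)
    show "integrable M (\<lambda>\<omega>. \<bar>Y 0 \<omega>\<bar>)" using int by simp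
    show "AE \<omega> in M. (\<lambda>i. \<bar>Y 0 \<omega> - Z (real i) (Y 0 \<omega>)\<bar>) \<longlonglongrightarrow> 0"
    proof (rule AE_I2, rule tendsto_eventually)
      fix \<omega>
      show "\<forall>\<^sub>F i in sequentially. \<bar>Y 0 \<omega> - Z (real i) (Y 0 \<omega>)\<bar> = 0"
        using eventually_ge_at_top[of "nat \<lceil>\<bar>Y 0 \<omega>\<bar>\<rceil>"]
        by eventually_elim (auto simp: Z_def nat_ceiling_le_eq)
    qed
  qed (auto simp: Z_abs)
  \<comment> \<open>The first bound serves the shift of the mean, the second one Markov's inequality.\<close>
  define \<eta> where "\<eta> = min (\<delta> / 3) (\<delta> * \<epsilon> / 6)"
  have "0 < \<eta>" using \<open>0 < \<epsilon>\<close> \<open>0 < \<delta>\<close> by (simp add: \<eta>_def)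
  then have "\<forall>\<^sub>F i in sequentially. expectation (\<lambda>\<omega>. \<bar>Y 0 \<omega> - Z (real i) (Y 0 \<omega>)\<bar>) < \<eta>"
    by (intro order_tendstoD(2)[OF lim]) simp
  from eventually_happens[OF this]
  obtain i where i: "expectation (\<lambda>\<omega>. \<bar>Y 0 \<omega> - Z (real i) (Y 0 \<omega>)\<bar>) < \<eta>"
    by auto
  define K where "K = real i"
  define R where "R y = \<bar>y - Z K y\<bar>" for y
  have [measurable]: "R \<in> borel_measurable borel" unfolding R_def by measurable
  have R: "expectation (\<lambda>\<omega>. R (Y 0 \<omega>)) < \<eta>" using i by (simp add: R_def K_def)
  have intZ: "integrable M (\<lambda>\<omega>. Z K (Y 0 \<omega>))"
    by (rule Bochner_Integration.integrable_bound[OF int]) (auto simp: Z_abs)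
  have int_distr: "integrable M (\<lambda>\<omega>. f (Y n \<omega>)) \<and>
      expectation (\<lambda>\<omega>. f (Y n \<omega>)) = expectation (\<lambda>\<omega>. f (Y 0 \<omega>))"
    if [measurable]: "f \<in> borel_measurable borel" and "integrable M (\<lambda>\<omega>. f (Y 0 \<omega>))"
    for f :: "real \<Rightarrow> real" and n
    using that integrable_distr_eq[of "Y n" M borel f] integrable_distr_eq[of "Y 0" M borel f]
      integral_distr[of "Y n" M borel f] integral_distr[of "Y 0" M borel f] ident[of n]
    by auto
  have intR0: "integrable M (\<lambda>\<omega>. R (Y 0 \<omega>))" using int intZ by (simp add: R_def)
  have intR: "integrable M (\<lambda>\<omega>. R (Y n \<omega>))"
      "expectation (\<lambda>\<omega>. R (Y n \<omega>)) = expectation (\<lambda>\<omega>. R (Y 0 \<omega>))" for n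
    using int_distr[OF _ intR0] by auto
  define \<mu> \<mu>' where "\<mu> = expectation (Y 0)" and "\<mu>' = expectation (\<lambda>\<omega>. Z K (Y 0 \<omega>))"
  have mu: "\<bar>\<mu> - \<mu>'\<bar> \<le> \<delta> / 3"
  proof -
    have "\<bar>\<mu> - \<mu>'\<bar> = \<bar>expectation (\<lambda>\<omega>. Y 0 \<omega> - Z K (Y 0 \<omega>))\<bar>"
      using int intZ by (simp add: \<mu>_def \<mu>'_def)
    also have "\<dots> \<le> expectation (\<lambda>\<omega>. R (Y 0 \<omega>))"
      unfolding R_def by (rule integral_abs_bound)
    finally show ?thesis using R by (simp add: \<eta>_def)
  qed
  have bound: "\<P>(\<omega> in M. \<delta> * real n \<le> \<bar>(\<Sum>k<n. Y k \<omega>) - real n * \<mu>\<bar>) \<le>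
      2 * exp (- 2 * (\<delta> / 3 * real n)\<^sup>2 / (real n * (2 * K + 2)\<^sup>2)) + \<epsilon> / 2" if "0 < n" for n
  proof -
    \<comment> \<open>The bounds \<open>K + 1\<close> keep the interval nondegenerate, as \<open>K\<close> may be 0.\<close>
    interpret H: Hoeffding_ineq_iid M "{..<n}" "\<lambda>k \<omega>. Z K (Y k \<omega>)" "\<lambda>\<omega>. Z K (Y 0 \<omega>)"
        "- (K + 1)" "K + 1" "\<mu>'"
    proof unfold_locales
      show "indep_vars (\<lambda>_. borel) (\<lambda>k \<omega>. Z K (Y k \<omega>)) {..<n}"
        by (rule indep_vars_compose2[OF indep_vars_subset[OF indep]]) auto
      show "distr M borel (\<lambda>\<omega>. Z K (Y k \<omega>)) = distr M borel (\<lambda>\<omega>. Z K (Y 0 \<omega>))" for k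
        using distr_distr[of "Z K" borel borel "Y k" M] distr_distr[of "Z K" borel borel "Y 0" M]
          ident[of k] by (simp add: comp_def)
      show "AE \<omega> in M. Z K (Y 0 \<omega>) \<in> {- (K + 1)..K + 1}"
        by (rule AE_I2) (auto simp: Z_def K_def)
    qed (simp_all add: \<mu>'_def)
    let ?A = "{\<omega>\<in>space M. \<bar>(\<Sum>k<n. Z K (Y k \<omega>)) - real n * \<mu>'\<bar> \<ge> \<delta> / 3 * real n}"
    let ?B = "{\<omega>\<in>space M. (\<Sum>k<n. R (Y k \<omega>)) \<ge> \<delta> / 3 * real n}"
    have "prob {\<omega>\<in>space M. \<delta> * real n \<le> \<bar>(\<Sum>k<n. Y k \<omega>) - real n * \<mu>\<bar>} \<le> prob (?A \<union> ?B)"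
    proof (rule finite_measure_mono)
      show "{\<omega>\<in>space M. \<delta> * real n \<le> \<bar>(\<Sum>k<n. Y k \<omega>) - real n * \<mu>\<bar>} \<subseteq> ?A \<union> ?B"
      proof (rule subsetI, rule ccontr)
        fix \<omega> assume \<omega>: "\<omega> \<in> {\<omega>\<in>space M. \<delta> * real n \<le> \<bar>(\<Sum>k<n. Y k \<omega>) - real n * \<mu>\<bar>}"
          "\<omega> \<notin> ?A \<union> ?B"
        have "\<bar>(\<Sum>k<n. Y k \<omega>) - (\<Sum>k<n. Z K (Y k \<omega>))\<bar> \<le> (\<Sum>k<n. R (Y k \<omega>))"
          unfolding R_def sum_subtractf[symmetric] by (rule sum_abs)
        moreover have "\<bar>real n * \<mu> - real n * \<mu>'\<bar> \<le> \<delta> / 3 * real n"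
          using mult_right_mono[OF mu, of "real n"]
          by (simp add: abs_mult mult.commute flip: left_diff_distrib)
        moreover have "\<bar>(\<Sum>k<n. Z K (Y k \<omega>)) - real n * \<mu>'\<bar> < \<delta> / 3 * real n"
          "(\<Sum>k<n. R (Y k \<omega>)) < \<delta> / 3 * real n"
          "\<delta> * real n \<le> \<bar>(\<Sum>k<n. Y k \<omega>) - real n * \<mu>\<bar>"
          using \<omega> by auto
        ultimately show False by linarith
      qed
    qed auto
    also have "\<dots> \<le> prob ?A + prob ?B" by (rule measure_Un_le) auto
    also have "prob ?A \<le> 2 * exp (- 2 * (\<delta> / 3 * real n)\<^sup>2 / (real n * (2 * K + 2)\<^sup>2))"
      using H.Hoeffding_ineq_abs_ge[of "\<delta> / 3 * real n"] \<open>0 < \<delta>\<close> \<open>0 < n\<close>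
      by (simp add: K_def lessThan_empty_iff algebra_simps)
    also have "prob ?B \<le> \<epsilon> / 2"
    proof -
      have "prob ?B \<le> expectation (\<lambda>\<omega>. \<Sum>k<n. R (Y k \<omega>)) / (\<delta> / 3 * real n)"
        using \<open>0 < \<delta>\<close> \<open>0 < n\<close> intR
        by (intro integral_Markov_inequality_measure) (auto simp: R_def intro!: sum_nonneg)
      also have "expectation (\<lambda>\<omega>. \<Sum>k<n. R (Y k \<omega>)) = (\<Sum>k<n. expectation (\<lambda>\<omega>. R (Y k \<omega>)))"
        by (rule Bochner_Integration.integral_sum) (rule intR)
      also have "\<dots> = (\<Sum>k<n. expectation (\<lambda>\<omega>. R (Y 0 \<omega>)))"
        by (rule sum.cong[OF refl intR(2)])
      also have "\<dots> = real n * expectation (\<lambda>\<omega>. R (Y 0 \<omega>))" by simp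
      also have "real n * expectation (\<lambda>\<omega>. R (Y 0 \<omega>)) / (\<delta> / 3 * real n)
          = expectation (\<lambda>\<omega>. R (Y 0 \<omega>)) / (\<delta> / 3)"
        using \<open>0 < n\<close> by simp
      also have "\<dots> \<le> (\<delta> * \<epsilon> / 6) / (\<delta> / 3)"
        using R \<open>0 < \<delta>\<close> by (intro divide_right_mono) (auto simp: \<eta>_def)
      finally show ?thesis using \<open>0 < \<delta>\<close> by simp
    qed
    finally show ?thesis by simp
  qed
  have "(\<lambda>n. 2 * exp (- 2 * (\<delta> / 3 * real n)\<^sup>2 / (real n * (2 * K + 2)\<^sup>2))) \<longlonglongrightarrow> 0"
  proof -
    have "0 < 2 * K + 2" by (simp add: K_def)
    then show ?thesis using \<open>0 < \<delta>\<close> by real_asymp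
  qed
  then have "\<forall>\<^sub>F n in sequentially. 2 * exp (- 2 * (\<delta> / 3 * real n)\<^sup>2 / (real n * (2 * K + 2)\<^sup>2)) < \<epsilon> / 2"
    by (rule order_tendstoD) (use \<open>0 < \<epsilon>\<close> in simp)
  then have "\<forall>\<^sub>F n in sequentially.
      norm (\<P>(\<omega> in M. \<delta> * real n \<le> \<bar>(\<Sum>k<n. Y k \<omega>) - real n * \<mu>\<bar>) - 0) < \<epsilon>"
    using eventually_gt_at_top[of 0]
  proof eventually_elim
    case (elim n)
    then show ?case using bound[of n] by simp
  qed
  then show "\<exists>n0. \<forall>n\<ge>n0. norm (\<P>(\<omega> in M. \<delta> * real n \<le> \<bar>(\<Sum>k<n. Y k \<omega>) - real n * expectation (Y 0)\<bar>) - 0) < \<epsilon>"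
    by (simp add: eventually_sequentially \<mu>_def)
qed

lemma (in prob_space) indep_vars_reindex_inj:
  assumes ind: "indep_vars N Y (f ` I)" and inj: "inj_on f I"
  shows "indep_vars (\<lambda>i. N (f i)) (\<lambda>i. Y (f i)) I"
  unfolding indep_vars_def2
proof (intro conjI ballI indep_setsI)
  show rv: "random_variable (N (f i)) (Y (f i))" if "i \<in> I" for i
    using ind that by (auto simp: indep_vars_def2)
  show "{Y (f i) -` A \<inter> space M |A. A \<in> sets (N (f i))} \<subseteq> events" if "i \<in> I" for i
    using rv[OF that] by auto
  fix A J assume J: "J \<noteq> {}" "J \<subseteq> I" "finite J"
    and A: "\<forall>j\<in>J. A j \<in> {Y (f j) -` A \<inter> space M |A. A \<in> sets (N (f j))}"
  define g where "g = the_inv_into J f"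
  have g: "g (f j) = j" if "j \<in> J" for j
    using that J inj by (auto simp: g_def the_inv_into_f_f inj_on_subset)
  have "prob (\<Inter>j\<in>f ` J. A (g j)) = (\<Prod>j\<in>f ` J. prob (A (g j)))"
    by (rule indep_setsD[of "\<lambda>i. {Y i -` A \<inter> space M |A. A \<in> sets (N i)}" "f ` I"])
       (use ind J A g in \<open>auto simp: indep_vars_def2\<close>)
  then show "prob (\<Inter>j\<in>J. A j) = (\<Prod>j\<in>J. prob (A j))"
    using J inj by (simp add: g prod.reindex inj_on_subset)
qed

section \<open>Order statistics and exceedance counts\<close>

lemma sorted_nth_greater_iff:
  fixes x :: "'a :: linorder"
  assumes "sorted xs" "i < length xs"
  shows "x < xs ! i \<longleftrightarrow> length xs - i \<le> length (filter (\<lambda>v. x < v) xs)"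
  using assms
proof (induction xs arbitrary: i)
  case (Cons y ys)
  show ?case
  proof (cases i)
    case 0
    show ?thesis
    proof (cases "x < y")
      case True
      then have "filter (\<lambda>v. x < v) ys = ys"
        using Cons.prems(1) by (auto simp: filter_id_conv)
      then show ?thesis using 0 True by simp
    next
      case False
      then show ?thesis using 0 by (simp add: not_le less_Suc_eq_le)
    qed
  next
    case (Suc i')
    have IH: "x < ys ! i' \<longleftrightarrow> length ys - i' \<le> length (filter (\<lambda>v. x < v) ys)"
      using Cons Suc by auto
    show ?thesis
    proof (cases "x < y")
      case True
      then have "filter (\<lambda>v. x < v) ys = ys"
        using Cons.prems(1) by (auto simp: filter_id_conv)
      then show ?thesis using IH Suc True by auto
    qed (use IH Suc in auto)
  qed
qed simp

text \<open>
  The bridge from order statistics to counting: the events of interest concern only the number of values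
  above the level \<open>x\<close>, and such numbers are additive over cycles.
\<close>

lemma kth_largest_greater_iff:
  assumes "finite A" "1 \<le> q"
  shows "ereal x < kth_largest q f A \<longleftrightarrow> q \<le> card {k \<in> A. x < f k}"
proof -
  define xs where "xs = sorted_list_of_multiset (image_mset f (mset_set A))"
  have mset_xs: "mset xs = image_mset f (mset_set A)" by (simp add: xs_def)
  have len: "length xs = card A" by (metis mset_xs size_mset size_image_mset size_mset_set)
  have "length (filter (\<lambda>v. x < v) xs) = size (filter_mset (\<lambda>v. x < v) (mset xs))"
    by (metis mset_filter size_mset)
  also have "\<dots> = card {k \<in> A. x < f k}"
    using assms by (simp add: mset_xs filter_mset_image_mset)
  finally have count: "length (filter (\<lambda>v. x < v) xs) = card {k \<in> A. x < f k}" .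
  have le: "card {k \<in> A. x < f k} \<le> card A" using assms by (intro card_mono) auto
  show ?thesis
  proof (cases "q \<le> card A")
    case True
    then have "rev xs ! (q - 1) = xs ! (card A - q)"
      using assms len by (subst rev_nth) auto
    moreover have "x < xs ! (card A - q) \<longleftrightarrow> q \<le> card {k \<in> A. x < f k}"
      using sorted_nth_greater_iff[of xs "card A - q" x] True assms len count
      by (auto simp: xs_def)
    ultimately show ?thesis using True by (simp add: kth_largest_def xs_def)
  next
    case False
    then show ?thesis using le by (simp add: kth_largest_def)
  qed
qed


section \<open>Exceedances in the cycles\<close>

locale max_regenerative_process = prob_space M for M :: "'a measure" +
  fixes X :: "nat \<Rightarrow> 'a \<Rightarrow> real" and S :: "nat \<Rightarrow> 'a \<Rightarrow> nat" and r :: nat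
  assumes r_pos: "1 \<le> r"
    and X_measurable [measurable]: "\<And>n. X n \<in> borel_measurable M"
    and regenerative: "max_regenerative M r X S"
    and integrable_length: "integrable M (\<lambda>\<omega>. real (cycle_length S 1 \<omega>))"
begin

lemma S_measurable [measurable]: "S n \<in> measurable M (count_space UNIV)"
  using regenerative unfolding max_regenerative_def by blast

lemma AE_S_increasing: "AE \<omega> in M. 0 < S 0 \<omega> \<and> (\<forall>n. S n \<omega> < S (Suc n) \<omega>)"
  using regenerative unfolding max_regenerative_def by blast

text \<open>
  The number of exceedances in a cycle, truncated at \<open>r\<close> (see \<open>excess_eq_min\<close>). The truncated number is a
  function of the first \<open>r\<close> cycle maxima, whose law and independence are given, whereas those of the full
  number \<open>cycle_hits\<close> are unknown.
\<close>

definition excess :: "real \<Rightarrow> nat \<Rightarrow> 'a \<Rightarrow> nat" where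
  "excess x n \<omega> = card {i \<in> {1..r}. ereal x < cycle_max X S i n \<omega>}"

definition cycle_hits :: "real \<Rightarrow> nat \<Rightarrow> 'a \<Rightarrow> nat" where
  "cycle_hits x n \<omega> = card {k \<in> {cycle_start S n \<omega>..<S n \<omega>}. x < X k \<omega>}"

lemma cycle_max_greater_iff:
  "1 \<le> i \<Longrightarrow> ereal x < cycle_max X S i n \<omega> \<longleftrightarrow> i \<le> cycle_hits x n \<omega>"
  unfolding cycle_max_def cycle_hits_def by (rule kth_largest_greater_iff) auto

lemma excess_eq_min: "excess x n \<omega> = min r (cycle_hits x n \<omega>)"
proof -
  have "{i \<in> {1..r}. ereal x < cycle_max X S i n \<omega>} = {1..min r (cycle_hits x n \<omega>)}"
    by (auto simp: cycle_max_greater_iff)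
  then show ?thesis by (simp add: excess_def)
qed

lemma cycle_max_greater_iff_excess:
  "i \<in> {1..r} \<Longrightarrow> ereal x < cycle_max X S i n \<omega> \<longleftrightarrow> i \<le> excess x n \<omega>"
  by (auto simp: cycle_max_greater_iff excess_eq_min)

lemma indep_excess: "indep_vars (\<lambda>_. borel) (\<lambda>n \<omega>. real (excess x n \<omega>)) UNIV"
  and distr_excess: "1 \<le> n \<Longrightarrow>
        distr M borel (\<lambda>\<omega>. real (excess x n \<omega>)) = distr M borel (\<lambda>\<omega>. real (excess x 1 \<omega>))"
proof -
  define h :: "(nat \<Rightarrow> ereal) \<Rightarrow> real" where
    "h v = (\<Sum>i\<in>{1..r}. indicator {ereal x<..} (v i))" for v
  let ?P = "Pi\<^sub>M {1..r} (\<lambda>_. borel :: ereal measure)"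
  let ?V = "\<lambda>n \<omega>. \<lambda>i\<in>{1..r}. cycle_max X S i n \<omega>"
  have h [measurable]: "h \<in> borel_measurable ?P"
    unfolding h_def by measurable
  have W: "real (excess x n \<omega>) = h (?V n \<omega>)" for n \<omega>
  proof -
    have "h (?V n \<omega>) = (\<Sum>i\<in>{1..r}. if ereal x < cycle_max X S i n \<omega> then 1 else 0)"
      unfolding h_def by (intro sum.cong) (auto simp: indicator_def)
    also have "\<dots> = real (excess x n \<omega>)"
      unfolding excess_def by (subst sum.inter_filter[symmetric]) simp_all
    finally show ?thesis ..
  qed
  have ind: "indep_vars (\<lambda>_. ?P) ?V UNIV"
    using regenerative unfolding max_regenerative_def by blast
  show "indep_vars (\<lambda>_. borel) (\<lambda>n \<omega>. real (excess x n \<omega>)) UNIV"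
    unfolding W by (rule indep_vars_compose2[OF ind]) (rule h)
  have V [measurable]: "?V n \<in> measurable M ?P" for n
    using ind by (auto simp: indep_vars_def)
  have "distr M ?P (?V n) = distr M ?P (?V 1)" if "1 \<le> n"
    using regenerative that unfolding max_regenerative_def by blast
  then show "distr M borel (\<lambda>\<omega>. real (excess x n \<omega>)) = distr M borel (\<lambda>\<omega>. real (excess x 1 \<omega>))"
    if "1 \<le> n"
    using that distr_distr[OF h V[of n]] distr_distr[OF h V[of 1]]
    unfolding W comp_def by metis
qed

lemma excess_measurable [measurable]: "excess x n \<in> measurable M (count_space UNIV)"
proof -
  have [measurable]: "(\<lambda>\<omega>. real (excess x n \<omega>)) \<in> borel_measurable M"
    using indep_excess[of x] by (auto simp: indep_vars_def)
  have "excess x n = (\<lambda>\<omega>. nat \<lfloor>real (excess x n \<omega>)\<rfloor>)" by (simp add: fun_eq_iff)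
  also have "\<dots> \<in> measurable M (count_space UNIV)" by measurable
  finally show ?thesis .
qed

lemma cycle_max_measurable [measurable]: "i \<in> {1..r} \<Longrightarrow> cycle_max X S i n \<in> borel_measurable M"
proof -
  assume i: "i \<in> {1..r}"
  have "(\<lambda>\<omega>. \<lambda>i\<in>{1..r}. cycle_max X S i n \<omega>) \<in> measurable M (Pi\<^sub>M {1..r} (\<lambda>_. borel))"
    using regenerative unfolding max_regenerative_def indep_vars_def by blast
  from measurable_compose[OF this measurable_component_singleton[OF i]] i
  show ?thesis by simp
qed

lemma prob_excess_eq:
  assumes "1 \<le> n"
  shows "prob {\<omega> \<in> space M. excess x n \<omega> = i} = prob {\<omega> \<in> space M. excess x 1 \<omega> = i}"
proof -
  have "prob {\<omega> \<in> space M. excess x n \<omega> = i} =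
      measure (distr M borel (\<lambda>\<omega>. real (excess x n \<omega>))) {real i}" for n
    by (subst measure_distr) (auto intro!: arg_cong[where f = prob])
  with distr_excess[OF assms] show ?thesis by simp
qed

definition max_cdf :: "real \<Rightarrow> real" where
  "max_cdf x = \<P>(\<omega> in M. cycle_max X S 1 1 \<omega> \<le> ereal x)"

lemma max_cdf_eq: "max_cdf x = prob {\<omega> \<in> space M. excess x 1 \<omega> = 0}"
  unfolding max_cdf_def using cycle_max_greater_iff_excess[of 1 x 1] r_pos
  by (intro arg_cong[where f = prob]) (auto simp flip: not_less)

lemma max_cdf_bounds: "max_cdf x \<in> {0..1}"
  by (simp add: max_cdf_def)

lemma prob_excess_pos: "prob {\<omega> \<in> space M. 0 < excess x 1 \<omega>} = 1 - max_cdf x"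
proof -
  have "prob (space M - {\<omega> \<in> space M. excess x 1 \<omega> = 0}) = 1 - max_cdf x"
    unfolding max_cdf_eq by (rule prob_compl) simp
  also have "space M - {\<omega> \<in> space M. excess x 1 \<omega> = 0} = {\<omega> \<in> space M. 0 < excess x 1 \<omega>}"
    by auto
  finally show ?thesis .
qed

text \<open>
  If exceedances have probability 0, then both sides are 0, whatever the value of \<open>cycle_beta\<close>.
\<close>

lemma cycle_beta_eq:
  assumes "1 \<le> i" "i < r"
  shows "(1 - max_cdf x) * cycle_beta M X S i x = prob {\<omega> \<in> space M. excess x 1 \<omega> = i}"
proof -
  have "cycle_max X S (i + 1) 1 \<omega> \<le> ereal x \<and> ereal x < cycle_max X S i 1 \<omega> \<longleftrightarrow> excess x 1 \<omega> = i"
    "ereal x < cycle_max X S 1 1 \<omega> \<longleftrightarrow> 0 < excess x 1 \<omega>" for \<omega>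
    using cycle_max_greater_iff_excess[of "i + 1" x 1 \<omega>] cycle_max_greater_iff_excess[of i x 1 \<omega>]
      cycle_max_greater_iff_excess[of 1 x 1 \<omega>] assms r_pos
    by (auto simp flip: not_less)
  then have "cycle_beta M X S i x =
      prob {\<omega> \<in> space M. excess x 1 \<omega> = i \<and> 0 < excess x 1 \<omega>} / (1 - max_cdf x)"
    using prob_excess_pos[of x] by (simp add: cycle_beta_def cond_prob_def)
  also have "{\<omega> \<in> space M. excess x 1 \<omega> = i \<and> 0 < excess x 1 \<omega>} = {\<omega> \<in> space M. excess x 1 \<omega> = i}"
    using assms by auto
  finally have beta: "cycle_beta M X S i x = prob {\<omega> \<in> space M. excess x 1 \<omega> = i} / (1 - max_cdf x)" .
  have "prob {\<omega> \<in> space M. excess x 1 \<omega> = i} \<le> 1 - max_cdf x"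
    unfolding prob_excess_pos[symmetric] using assms by (intro finite_measure_mono) auto
  then show ?thesis
    using beta by (cases "max_cdf x = 1") (auto simp: measure_le_0_iff)
qed

lemma cycle_beta_nonneg: "0 \<le> cycle_beta M X S i x"
  by (simp add: cycle_beta_def cond_prob_def)

lemma sum_cycle_beta_le_1:
  assumes "N < r"
  shows "(\<Sum>i=1..N. cycle_beta M X S i x) \<le> 1"
proof (cases "max_cdf x = 1")
  case True
  have "cycle_beta M X S i x = 0" if "i \<in> {1..N}" for i
  proof -
    have "prob {\<omega> \<in> space M. ereal x < cycle_max X S 1 1 \<omega>} = 0"
      using True prob_excess_pos[of x] cycle_max_greater_iff_excess[of 1 x 1] r_pos
      by (simp add: Suc_le_eq)
    then show ?thesis by (simp add: cycle_beta_def cond_prob_def)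
  qed
  then show ?thesis by simp
next
  case False
  then have pos: "0 < 1 - max_cdf x" using max_cdf_bounds[of x] by auto
  have "(1 - max_cdf x) * (\<Sum>i=1..N. cycle_beta M X S i x) =
      (\<Sum>i\<in>{1..N}. prob {\<omega> \<in> space M. excess x 1 \<omega> = i})"
    using assms by (auto simp: sum_distrib_left cycle_beta_eq intro!: sum.cong)
  also have "\<dots> = prob (\<Union>i\<in>{1..N}. {\<omega> \<in> space M. excess x 1 \<omega> = i})"
    by (rule finite_measure_finite_Union[symmetric]) (auto simp: disjoint_family_on_def)
  also have "\<dots> \<le> 1 - max_cdf x"
    unfolding prob_excess_pos[symmetric] by (intro finite_measure_mono) auto
  finally show ?thesis using pos by simp
qed

lemma cycle_gamma_eq:
  "cycle_gamma M X S q k x = jump_sum_cdf (\<lambda>i. cycle_beta M X S i x) (q - 1) k (q - 1)"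
  by (simp add: cycle_gamma_def jump_sum_cdf_def gamma_index_def multiplicities_def)

lemma cycle_gamma_bounds:
  assumes "2 \<le> q" "q \<le> r"
  shows "cycle_gamma M X S q k x \<in> {0..1}"
  unfolding cycle_gamma_eq using assms
  by (intro jump_sum_cdf_bounds cycle_beta_nonneg sum_cycle_beta_le_1) auto

definition excess_sum_cdf :: "real \<Rightarrow> nat \<Rightarrow> nat \<Rightarrow> real" where
  "excess_sum_cdf x m s = prob {\<omega> \<in> space M. (\<Sum>k<m. excess x (Suc k) \<omega>) \<le> s}"

lemma excess_sum_cdf_Suc:
  "excess_sum_cdf x (Suc m) s =
     (\<Sum>i\<le>s. prob {\<omega> \<in> space M. excess x 1 \<omega> = i} * excess_sum_cdf x m (s - i))"
proof -
  let ?T = "\<lambda>\<omega>. \<Sum>k<m. excess x (Suc k) \<omega>"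
  have "indep_var borel (\<lambda>\<omega>. real (excess x (Suc m) \<omega>))
      borel (\<lambda>\<omega>. \<Sum>k\<in>Suc ` {..<m}. real (excess x k \<omega>))"
    by (rule indep_vars_sum) (auto intro: indep_vars_subset[OF indep_excess])
  then have ind: "indep_var borel (\<lambda>\<omega>. real (excess x (Suc m) \<omega>)) borel (\<lambda>\<omega>. real (?T \<omega>))"
    by (simp add: sum.reindex)
  have step: "prob {\<omega> \<in> space M. excess x (Suc m) \<omega> = i \<and> ?T \<omega> \<le> s - i} =
      prob {\<omega> \<in> space M. excess x 1 \<omega> = i} * excess_sum_cdf x m (s - i)" for i
  proof -
    have "prob {\<omega> \<in> space M. excess x (Suc m) \<omega> = i \<and> ?T \<omega> \<le> s - i} =
        prob ((\<lambda>\<omega>. (real (excess x (Suc m) \<omega>), real (?T \<omega>))) -` ({real i} \<times> {..real (s - i)}) \<inter> space M)"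
      by (intro arg_cong[where f = prob]) (auto simp del: of_nat_sum)
    also have "\<dots> = prob ((\<lambda>\<omega>. real (excess x (Suc m) \<omega>)) -` {real i} \<inter> space M) *
        prob ((\<lambda>\<omega>. real (?T \<omega>)) -` {..real (s - i)} \<inter> space M)"
      by (rule indep_varD[OF ind]) auto
    also have "(\<lambda>\<omega>. real (excess x (Suc m) \<omega>)) -` {real i} \<inter> space M =
        {\<omega> \<in> space M. excess x (Suc m) \<omega> = i}" by auto
    also have "(\<lambda>\<omega>. real (?T \<omega>)) -` {..real (s - i)} \<inter> space M = {\<omega> \<in> space M. ?T \<omega> \<le> s - i}"
      by (auto simp del: of_nat_sum)
    finally show ?thesis by (simp add: excess_sum_cdf_def prob_excess_eq[of "Suc m"])
  qed
  have "{\<omega> \<in> space M. (\<Sum>k<Suc m. excess x (Suc k) \<omega>) \<le> s} =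
      (\<Union>i\<le>s. {\<omega> \<in> space M. excess x (Suc m) \<omega> = i \<and> ?T \<omega> \<le> s - i})"
    by auto
  then have "excess_sum_cdf x (Suc m) s =
      prob (\<Union>i\<le>s. {\<omega> \<in> space M. excess x (Suc m) \<omega> = i \<and> ?T \<omega> \<le> s - i})"
    by (simp add: excess_sum_cdf_def)
  also have "\<dots> = (\<Sum>i\<le>s. prob {\<omega> \<in> space M. excess x (Suc m) \<omega> = i \<and> ?T \<omega> \<le> s - i})"
    by (rule finite_measure_finite_Union) (auto simp: disjoint_family_on_def)
  finally show ?thesis by (simp add: step)
qed

lemma excess_sum_cdf_eq:
  assumes "2 \<le> q" "q \<le> r"
  shows "excess_sum_cdf x m (q - 1) =
    (\<Sum>k\<le>q - 1. binomial_prob m (max_cdf x) k * cycle_gamma M X S q k x)"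
  unfolding cycle_gamma_eq
proof (rule binomial_mixture_eq)
  show "excess_sum_cdf x 0 s = 1" for s
    by (simp add: excess_sum_cdf_def prob_space)
  show "excess_sum_cdf x (Suc m) s = max_cdf x * excess_sum_cdf x m s +
      (\<Sum>i=1..s. (1 - max_cdf x) * cycle_beta M X S i x * excess_sum_cdf x m (s - i))"
    if "s \<le> q - 1" for m s
  proof -
    have "{..s} - {0} = {1..s}" by auto
    then have "excess_sum_cdf x (Suc m) s = max_cdf x * excess_sum_cdf x m s +
        (\<Sum>i=1..s. prob {\<omega> \<in> space M. excess x 1 \<omega> = i} * excess_sum_cdf x m (s - i))"
      by (simp add: excess_sum_cdf_Suc max_cdf_eq sum.remove[of "{..s}" 0])
    also have "(\<Sum>i=1..s. prob {\<omega> \<in> space M. excess x 1 \<omega> = i} * excess_sum_cdf x m (s - i)) =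
        (\<Sum>i=1..s. (1 - max_cdf x) * cycle_beta M X S i x * excess_sum_cdf x m (s - i))"
      using that assms by (intro sum.cong refl arg_cong2[where f = times] cycle_beta_eq[symmetric]) auto
    finally show ?thesis .
  qed
qed simp

section \<open>Regeneration times\<close>

definition \<mu> :: real where "\<mu> = mean_cycle_length M S"

lemma mean_eq: "\<mu> = expectation (\<lambda>\<omega>. real (cycle_length S 1 \<omega>))"
  by (simp add: \<mu>_def mean_cycle_length_def)

lemma mean_ge_1: "1 \<le> \<mu>"
proof -
  have "AE \<omega> in M. 1 \<le> real (cycle_length S 1 \<omega>)"
    using AE_S_increasing
  proof eventually_elim
    case (elim \<omega>)
    then have "S 0 \<omega> < S (Suc 0) \<omega>" by blast
    then show ?case by (simp add: cycle_length_def cycle_start_def)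
  qed
  then have "expectation (\<lambda>_. 1) \<le> \<mu>"
    unfolding mean_eq by (intro integral_mono_AE integrable_length) auto
  then show ?thesis by (simp add: prob_space)
qed

lemma S_eq_sum:
  assumes "\<And>n. S n \<omega> < S (Suc n) \<omega>"
  shows "S m \<omega> = S 0 \<omega> + (\<Sum>k<m. cycle_length S (Suc k) \<omega>)"
proof (induction m)
  case (Suc m)
  then show ?case
    using assms[of m] by (simp add: cycle_length_def cycle_start_def)
qed simp

lemma cycle_length_law_of_large_numbers:
  assumes "0 < \<delta>"
  shows "(\<lambda>m. \<P>(\<omega> in M. \<delta> * real m \<le> \<bar>(\<Sum>k<m. real (cycle_length S (Suc k) \<omega>)) - real m * \<mu>\<bar>))
           \<longlonglongrightarrow> 0"
proof -
  have ind: "indep_vars (\<lambda>_. count_space UNIV) (cycle_length S) UNIV"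
    using regenerative unfolding max_regenerative_def by blast
  have [measurable]: "cycle_length S n \<in> measurable M (count_space UNIV)" for n
    using ind by (auto simp: indep_vars_def)
  have "indep_vars (\<lambda>_. count_space UNIV) (\<lambda>k. cycle_length S (Suc k)) UNIV"
    using indep_vars_reindex_inj[of "\<lambda>_. count_space UNIV" "cycle_length S" Suc UNIV]
      indep_vars_subset[OF ind] by simp
  then have "indep_vars (\<lambda>_. borel) (\<lambda>k \<omega>. real (cycle_length S (Suc k) \<omega>)) UNIV"
    by (rule indep_vars_compose2) simp
  moreover have "distr M borel (\<lambda>\<omega>. real (cycle_length S (Suc n) \<omega>)) =
      distr M borel (\<lambda>\<omega>. real (cycle_length S (Suc 0) \<omega>))" for n
  proof -
    have push: "distr M borel (\<lambda>\<omega>. real (cycle_length S k \<omega>)) =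
        distr (distr M (count_space UNIV) (cycle_length S k)) borel real" for k
      by (subst distr_distr) (auto simp: comp_def)
    have ident: "\<forall>n\<ge>1. distr M (count_space UNIV) (cycle_length S n) =
        distr M (count_space UNIV) (cycle_length S 1)"
      using regenerative unfolding max_regenerative_def by blast
    have same: "distr M (count_space UNIV) (cycle_length S (Suc n)) =
        distr M (count_space UNIV) (cycle_length S (Suc 0))"
      using ident[rule_format, of "Suc n"] by simp
    show ?thesis unfolding push same ..
  qed
  ultimately show ?thesis
    using weak_law_of_large_numbers[OF _ _ _ assms, of "\<lambda>k \<omega>. real (cycle_length S (Suc k) \<omega>)"]
      integrable_length by (simp add: mean_eq)
qed

text \<open>
  The time \<open>S m\<close> is the length \<open>S 0\<close> of the initial cycle plus \<open>m\<close> identically distributed lengths. For this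
  bound \<open>S 0\<close> may be dropped; in \<open>regeneration_time_late\<close> it is negligible because it is finite.
\<close>

lemma regeneration_time_early:
  assumes "0 < \<delta>"
  shows "(\<lambda>m. \<P>(\<omega> in M. real (S m \<omega>) \<le> (1 - \<delta>) * \<mu> * real m)) \<longlonglongrightarrow> 0"
proof -
  have pos: "0 < \<delta> * \<mu>" using assms mean_ge_1 by simp
  show ?thesis
  proof (rule tendsto_sandwich[OF _ _ tendsto_const cycle_length_law_of_large_numbers[OF pos]])
    have [measurable]: "cycle_length S n \<in> measurable M (count_space UNIV)" for n
      unfolding cycle_length_def cycle_start_def by measurable
    show "\<forall>\<^sub>F m in sequentially. \<P>(\<omega> in M. real (S m \<omega>) \<le> (1 - \<delta>) * \<mu> * real m) \<le>
        \<P>(\<omega> in M. \<delta> * \<mu> * real m \<le> \<bar>(\<Sum>k<m. real (cycle_length S (Suc k) \<omega>)) - real m * \<mu>\<bar>)"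
    proof (intro always_eventually allI, rule finite_measure_mono_AE)
      fix m
      show "AE \<omega> in M. \<omega> \<in> {\<omega> \<in> space M. real (S m \<omega>) \<le> (1 - \<delta>) * \<mu> * real m} \<longrightarrow>
          \<omega> \<in> {\<omega> \<in> space M. \<delta> * \<mu> * real m \<le> \<bar>(\<Sum>k<m. real (cycle_length S (Suc k) \<omega>)) - real m * \<mu>\<bar>}"
        using AE_S_increasing
      proof eventually_elim
        case (elim \<omega>)
        have "real (S m \<omega>) = real (S 0 \<omega>) + (\<Sum>k<m. real (cycle_length S (Suc k) \<omega>))"
          using S_eq_sum[of \<omega> m] elim by simp
        then show ?case by (auto simp: algebra_simps)
      qed
    qed measurable
  qed simp
qed

lemma regeneration_time_late:
  assumes "0 < \<delta>"
  shows "(\<lambda>m. \<P>(\<omega> in M. (1 + \<delta>) * \<mu> * real m \<le> real (S m \<omega>))) \<longlonglongrightarrow> 0"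
proof -
  have [measurable]: "cycle_length S n \<in> measurable M (count_space UNIV)" for n
    unfolding cycle_length_def cycle_start_def by measurable
  define \<eta> where "\<eta> = \<delta> * \<mu> / 2"
  have \<eta>: "0 < \<eta>" using assms mean_ge_1 by (simp add: \<eta>_def)
  let ?L = "\<lambda>m \<omega>. \<Sum>k<m. real (cycle_length S (Suc k) \<omega>)"
  let ?A = "\<lambda>m. {\<omega> \<in> space M. \<eta> * real m \<le> real (S 0 \<omega>)}"
  let ?B = "\<lambda>m. {\<omega> \<in> space M. \<eta> * real m \<le> \<bar>?L m \<omega> - real m * \<mu>\<bar>}"
  have "(\<lambda>m. prob (?A m)) \<longlonglongrightarrow> prob (\<Inter>m. ?A m)"
  proof (rule finite_Lim_measure_decseq)
    have "\<eta> * real m \<le> \<eta> * real n" if "m \<le> n" for m n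
      using \<eta> that by simp
    then show "decseq ?A" unfolding decseq_def by (blast intro: order_trans)
  qed auto
  also have "(\<Inter>m. ?A m) = {}"
  proof -
    have "\<exists>m. \<not> \<eta> * real m \<le> real (S 0 \<omega>)" for \<omega>
      using reals_Archimedean3[OF \<eta>, rule_format, of "real (S 0 \<omega>)"]
      by (auto simp: not_le mult.commute)
    then show ?thesis by auto
  qed
  finally have "(\<lambda>m. prob (?A m) + prob (?B m)) \<longlonglongrightarrow> 0 + 0"
    using cycle_length_law_of_large_numbers[OF \<eta>] by (intro tendsto_add) simp_all
  then have lim: "(\<lambda>m. prob (?A m) + prob (?B m)) \<longlonglongrightarrow> 0" by simp
  show ?thesis
  proof (rule tendsto_sandwich[OF _ _ tendsto_const lim])
    show "\<forall>\<^sub>F m in sequentially. \<P>(\<omega> in M. (1 + \<delta>) * \<mu> * real m \<le> real (S m \<omega>)) \<le>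
        prob (?A m) + prob (?B m)"
    proof (intro always_eventually allI)
      fix m
      have "\<P>(\<omega> in M. (1 + \<delta>) * \<mu> * real m \<le> real (S m \<omega>)) \<le> prob (?A m \<union> ?B m)"
      proof (rule finite_measure_mono_AE)
        show "AE \<omega> in M. \<omega> \<in> {\<omega> \<in> space M. (1 + \<delta>) * \<mu> * real m \<le> real (S m \<omega>)} \<longrightarrow>
            \<omega> \<in> ?A m \<union> ?B m"
          using AE_S_increasing
        proof eventually_elim
          case (elim \<omega>)
          have "real (S m \<omega>) = real (S 0 \<omega>) + ?L m \<omega>"
            using S_eq_sum[of \<omega> m] elim by simp
          moreover have "(1 + \<delta>) * \<mu> * real m = \<eta> * real m + \<eta> * real m + real m * \<mu>"
            by (simp add: \<eta>_def algebra_simps)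
          ultimately show ?case by auto
        qed
      qed measurable
      also have "\<dots> \<le> prob (?A m) + prob (?B m)" by (rule measure_Un_le) auto
      finally show "\<P>(\<omega> in M. (1 + \<delta>) * \<mu> * real m \<le> real (S m \<omega>)) \<le> prob (?A m) + prob (?B m)" .
    qed
  qed simp
qed

section \<open>Comparison of an order statistic with a fixed number of cycles\<close>

lemma order_stat_le_iff:
  "1 \<le> q \<Longrightarrow> order_stat X q n \<omega> \<le> ereal x \<longleftrightarrow> card {k \<in> {1..n}. x < X k \<omega>} < q"
  using kth_largest_greater_iff[of "{1..n}" q x "\<lambda>k. X k \<omega>"]
  by (simp add: order_stat_def flip: not_less)

lemma card_hits_eq_sum:
  assumes "\<And>n. S n \<omega> < S (Suc n) \<omega>"
  shows "card {k \<in> {S 0 \<omega>..<S m \<omega>}. x < X k \<omega>} = (\<Sum>k<m. cycle_hits x (Suc k) \<omega>)"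
proof (induction m)
  case (Suc m)
  have mono: "S 0 \<omega> \<le> S m \<omega>"
    using assms by (metis S_eq_sum le_add1)
  have "{k \<in> {S 0 \<omega>..<S (Suc m) \<omega>}. x < X k \<omega>} =
      {k \<in> {S 0 \<omega>..<S m \<omega>}. x < X k \<omega>} \<union> {k \<in> {S m \<omega>..<S (Suc m) \<omega>}. x < X k \<omega>}"
    using mono assms[of m] by auto
  also have "card \<dots> = card {k \<in> {S 0 \<omega>..<S m \<omega>}. x < X k \<omega>} + card {k \<in> {S m \<omega>..<S (Suc m) \<omega>}. x < X k \<omega>}"
    by (rule card_Un_disjoint) auto
  finally show ?case using Suc by (simp add: cycle_hits_def cycle_start_def)
qed simp

text \<open>
  For levels \<open>q \<le> r\<close> the truncation at \<open>r\<close> is invisible: if the truncated numbers add up to less than \<open>q\<close>,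
  then none of them was truncated.
\<close>

lemma sum_excess_less_iff:
  fixes f :: "nat \<Rightarrow> nat"
  assumes "q \<le> r"
  shows "(\<Sum>k<m. excess x (f k) \<omega>) < q \<longleftrightarrow> (\<Sum>k<m. cycle_hits x (f k) \<omega>) < q"
proof
  assume less: "(\<Sum>k<m. excess x (f k) \<omega>) < q"
  have "excess x (f k) \<omega> = cycle_hits x (f k) \<omega>" if "k < m" for k
  proof -
    have "excess x (f k) \<omega> \<le> (\<Sum>k<m. excess x (f k) \<omega>)"
      using that by (intro member_le_sum[of k "{..<m}"]) auto
    with less assms show ?thesis by (simp add: excess_eq_min)
  qed
  with less show "(\<Sum>k<m. cycle_hits x (f k) \<omega>) < q" by simp
next
  have "(\<Sum>k<m. excess x (f k) \<omega>) \<le> (\<Sum>k<m. cycle_hits x (f k) \<omega>)"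
    by (rule sum_mono) (simp add: excess_eq_min)
  then show "(\<Sum>k<m. cycle_hits x (f k) \<omega>) < q \<Longrightarrow> (\<Sum>k<m. excess x (f k) \<omega>) < q" by simp
qed

lemma order_stat_measurable_set [measurable]:
  "1 \<le> q \<Longrightarrow> {\<omega> \<in> space M. order_stat X q n \<omega> \<le> ereal x} \<in> sets M"
proof -
  assume q: "1 \<le> q"
  have "{\<omega> \<in> space M. order_stat X q n \<omega> \<le> ereal x} =
      {\<omega> \<in> space M. (\<Sum>k\<in>{1..n}. if x < X k \<omega> then 1 else 0 :: real) < real q}"
  proof -
    have "(\<Sum>k\<in>{1..n}. if x < X k \<omega> then 1 else 0 :: real) = real (card {k \<in> {1..n}. x < X k \<omega>})" for \<omega>
      by (subst sum.inter_filter[symmetric]) simp_all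
    then show ?thesis using q by (simp add: order_stat_le_iff)
  qed
  also have "\<dots> \<in> sets M" by measurable
  finally show ?thesis .
qed

text \<open>
  If the cycles \<open>1, \<dots>, m\<close> are completed by time \<open>n\<close>, then all their exceedances are among \<open>X\<^sub>1, \<dots>, X\<^sub>n\<close>, the
  initial cycle having at least one element. The indices of these cycles end at \<open>S m - 1\<close>, hence the bound
  \<open>n + 1\<close>.
\<close>

lemma order_stat_prob_le:
  assumes "1 \<le> q" "q \<le> r"
  shows "\<P>(\<omega> in M. order_stat X q n \<omega> \<le> ereal x) \<le>
           excess_sum_cdf x m (q - 1) + \<P>(\<omega> in M. n + 1 < S m \<omega>)"
proof -
  let ?A = "{\<omega> \<in> space M. (\<Sum>k<m. excess x (Suc k) \<omega>) \<le> q - 1}"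
  let ?B = "{\<omega> \<in> space M. n + 1 < S m \<omega>}"
  have "\<P>(\<omega> in M. order_stat X q n \<omega> \<le> ereal x) \<le> prob (?A \<union> ?B)"
  proof (rule finite_measure_mono_AE)
    show "AE \<omega> in M. \<omega> \<in> {\<omega> \<in> space M. order_stat X q n \<omega> \<le> ereal x} \<longrightarrow> \<omega> \<in> ?A \<union> ?B"
    proof (rule eventually_mono[OF AE_S_increasing], intro impI, rule ccontr)
      fix \<omega> assume S: "0 < S 0 \<omega> \<and> (\<forall>n. S n \<omega> < S (Suc n) \<omega>)"
        and le: "\<omega> \<in> {\<omega> \<in> space M. order_stat X q n \<omega> \<le> ereal x}" and not: "\<omega> \<notin> ?A \<union> ?B"
      have "{k \<in> {S 0 \<omega>..<S m \<omega>}. x < X k \<omega>} \<subseteq> {k \<in> {1..n}. x < X k \<omega>}"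
        using S not le by auto
      then have "(\<Sum>k<m. cycle_hits x (Suc k) \<omega>) \<le> card {k \<in> {1..n}. x < X k \<omega>}"
        using S by (subst card_hits_eq_sum[symmetric]) (auto intro: card_mono)
      also have "\<dots> < q" using le assms by (simp add: order_stat_le_iff)
      finally have "(\<Sum>k<m. excess x (Suc k) \<omega>) < q"
        using assms by (simp add: sum_excess_less_iff)
      then show False using not le by auto
    qed
  qed measurable
  also have "\<dots> \<le> prob ?A + prob ?B" by (rule measure_Un_le) auto
  finally show ?thesis by (simp add: excess_sum_cdf_def)
qed

text \<open>
  Conversely, if the cycles up to the \<open>m\<close>-th reach beyond \<open>n\<close> and the initial cycle has no exceedance, then
  the exceedances among \<open>X\<^sub>1, \<dots>, X\<^sub>n\<close> all lie in the cycles \<open>1, \<dots>, m\<close>.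
\<close>

lemma order_stat_prob_ge:
  assumes "1 \<le> q" "q \<le> r"
  shows "excess_sum_cdf x m (q - 1) \<le> \<P>(\<omega> in M. order_stat X q n \<omega> \<le> ereal x) +
           (\<P>(\<omega> in M. 0 < excess x 0 \<omega> \<and> (\<Sum>k<m. excess x (Suc k) \<omega>) < q) + \<P>(\<omega> in M. S m \<omega> \<le> n))"
proof -
  let ?A = "{\<omega> \<in> space M. order_stat X q n \<omega> \<le> ereal x}"
  let ?B = "{\<omega> \<in> space M. 0 < excess x 0 \<omega> \<and> (\<Sum>k<m. excess x (Suc k) \<omega>) < q}"
  let ?C = "{\<omega> \<in> space M. S m \<omega> \<le> n}"
  have "excess_sum_cdf x m (q - 1) \<le> prob (?A \<union> (?B \<union> ?C))"
    unfolding excess_sum_cdf_def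
  proof (rule finite_measure_mono_AE)
    show "AE \<omega> in M. \<omega> \<in> {\<omega> \<in> space M. (\<Sum>k<m. excess x (Suc k) \<omega>) \<le> q - 1} \<longrightarrow> \<omega> \<in> ?A \<union> (?B \<union> ?C)"
    proof (rule eventually_mono[OF AE_S_increasing], intro impI, rule ccontr)
      fix \<omega> assume S: "0 < S 0 \<omega> \<and> (\<forall>n. S n \<omega> < S (Suc n) \<omega>)"
        and le: "\<omega> \<in> {\<omega> \<in> space M. (\<Sum>k<m. excess x (Suc k) \<omega>) \<le> q - 1}"
        and not: "\<omega> \<notin> ?A \<union> (?B \<union> ?C)"
      have less: "(\<Sum>k<m. excess x (Suc k) \<omega>) < q" using le assms by auto
      have "excess x 0 \<omega> = 0" "n < S m \<omega>" using not le less by auto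
      then have zero: "cycle_hits x 0 \<omega> = 0" using r_pos by (simp add: excess_eq_min min_def split: if_splits)
      have "{k \<in> {1..n}. x < X k \<omega>} \<subseteq> {k \<in> {0..<S 0 \<omega>}. x < X k \<omega>} \<union> {k \<in> {S 0 \<omega>..<S m \<omega>}. x < X k \<omega>}"
        using \<open>n < S m \<omega>\<close> by auto
      also have "{k \<in> {0..<S 0 \<omega>}. x < X k \<omega>} = {}"
        using zero by (simp add: cycle_hits_def cycle_start_def)
      finally have "card {k \<in> {1..n}. x < X k \<omega>} \<le> (\<Sum>k<m. cycle_hits x (Suc k) \<omega>)"
        using S by (subst card_hits_eq_sum[symmetric]) (auto intro: card_mono)
      also have "\<dots> < q" using less assms by (simp add: sum_excess_less_iff)
      finally show False using not le assms by (simp add: order_stat_le_iff)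
    qed
  qed (use assms in measurable)
  also have "\<dots> \<le> prob ?A + prob (?B \<union> ?C)"
    using assms by (intro measure_Un_le) auto
  also have "prob (?B \<union> ?C) \<le> prob ?B + prob ?C" by (intro measure_Un_le) auto
  finally show ?thesis by simp
qed

section \<open>The initial cycle\<close>

definition first_cycle_dominates :: "nat \<Rightarrow> real" where
  "first_cycle_dominates l =
     \<P>(\<omega> in M. cycle_max X S 1 0 \<omega> > (MAX k\<in>{1..l}. cycle_max X S 1 k \<omega>))"

text \<open>
  Cut the first \<open>q * l\<close> of the \<open>m\<close> cycles into \<open>q\<close> blocks of length \<open>l\<close>. If there are fewer than \<open>q\<close>
  exceedances, then some block has none. By independence each block is as likely as the first one to be free
  of exceedances while the initial cycle has some, and in the case of the first block the initial cycle has
  a larger maximum than the next \<open>l\<close> cycles. The bound does not depend on \<open>x\<close>.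
\<close>

lemma first_cycle_excess_bound:
  assumes "1 \<le> q" "q \<le> m"
  shows "\<P>(\<omega> in M. 0 < excess x 0 \<omega> \<and> (\<Sum>k<m. excess x (Suc k) \<omega>) < q) \<le>
           real q * first_cycle_dominates (m div q)"
proof -
  define l where "l = m div q"
  have l: "1 \<le> l" "q * l \<le> m"
    using assms by (auto simp: l_def Suc_le_eq div_greater_zero_iff)
  define B where "B j = {\<omega> \<in> space M. 0 < excess x 0 \<omega> \<and>
      (\<forall>k\<in>{j * l..<j * l + l}. excess x (Suc k) \<omega> = 0)}" for j
  have [measurable]: "B j \<in> sets M" for j unfolding B_def by measurable
  have prob_B: "prob (B j) = prob {\<omega> \<in> space M. 0 < excess x 0 \<omega>} * max_cdf x ^ l" for j
  proof -
    let ?K = "Suc ` {j * l..<j * l + l}"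
    define A where "A k = (if k = 0 then {0<..} else {0::real})" for k :: nat
    have "B j = (\<Inter>k\<in>insert 0 ?K. (\<lambda>\<omega>. real (excess x k \<omega>)) -` A k \<inter> space M)"
      by (auto simp: B_def A_def simp del: image_Suc_atLeastLessThan)
    also have "prob \<dots> = (\<Prod>k\<in>insert 0 ?K. prob ((\<lambda>\<omega>. real (excess x k \<omega>)) -` A k \<inter> space M))"
      by (rule indep_varsD[OF indep_excess]) (auto simp: A_def)
    also have "\<dots> = prob ((\<lambda>\<omega>. real (excess x 0 \<omega>)) -` A 0 \<inter> space M) *
        (\<Prod>k\<in>?K. prob ((\<lambda>\<omega>. real (excess x k \<omega>)) -` A k \<inter> space M))"
      by (rule prod.insert) auto
    also have "(\<Prod>k\<in>?K. prob ((\<lambda>\<omega>. real (excess x k \<omega>)) -` A k \<inter> space M)) = (\<Prod>k\<in>?K. max_cdf x)"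
    proof (rule prod.cong[OF refl])
      fix k assume k: "k \<in> ?K"
      then have "(\<lambda>\<omega>. real (excess x k \<omega>)) -` A k \<inter> space M = {\<omega> \<in> space M. excess x k \<omega> = 0}"
        by (auto simp: A_def)
      moreover have "1 \<le> k" using k by auto
      ultimately show "prob ((\<lambda>\<omega>. real (excess x k \<omega>)) -` A k \<inter> space M) = max_cdf x"
        unfolding max_cdf_eq using prob_excess_eq[of k x 0] by metis
    qed
    also have "\<dots> = max_cdf x ^ l" by (simp add: card_image)
    also have "(\<lambda>\<omega>. real (excess x 0 \<omega>)) -` A 0 \<inter> space M = {\<omega> \<in> space M. 0 < excess x 0 \<omega>}"
      by (auto simp: A_def)
    finally show ?thesis .
  qed
  have B0: "prob (B 0) \<le> first_cycle_dominates l"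
    unfolding first_cycle_dominates_def
  proof (rule finite_measure_mono)
    show "B 0 \<subseteq> {\<omega> \<in> space M. (MAX k\<in>{1..l}. cycle_max X S 1 k \<omega>) < cycle_max X S 1 0 \<omega>}"
    proof
      fix \<omega> assume \<omega>: "\<omega> \<in> B 0"
      have gt: "ereal x < cycle_max X S 1 0 \<omega>"
        using \<omega> cycle_max_greater_iff_excess[of 1 x 0 \<omega>] r_pos by (simp add: B_def Suc_le_eq)
      have le: "cycle_max X S 1 k \<omega> \<le> ereal x" if "k \<in> {1..l}" for k
      proof -
        obtain k' where "k = Suc k'" "k' < l" using \<open>k \<in> {1..l}\<close> by (cases k) auto
        then have "excess x k \<omega> = 0" using \<omega> by (simp add: B_def)
        then show ?thesis
          using cycle_max_greater_iff_excess[of 1 x k \<omega>] r_pos by (simp flip: not_less)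
      qed
      have "(MAX k\<in>{1..l}. cycle_max X S 1 k \<omega>) \<le> ereal x"
        using l le by (intro Max.boundedI) auto
      with gt \<omega> show "\<omega> \<in> {\<omega> \<in> space M. (MAX k\<in>{1..l}. cycle_max X S 1 k \<omega>) < cycle_max X S 1 0 \<omega>}"
        by (auto simp: B_def)
    qed
    have [measurable]: "cycle_max X S 1 k \<in> borel_measurable M" for k
      using r_pos by (intro cycle_max_measurable) auto
    show "{\<omega> \<in> space M. (MAX k\<in>{1..l}. cycle_max X S 1 k \<omega>) < cycle_max X S 1 0 \<omega>} \<in> events"
      by measurable
  qed
  have "{\<omega> \<in> space M. 0 < excess x 0 \<omega> \<and> (\<Sum>k<m. excess x (Suc k) \<omega>) < q} \<subseteq> (\<Union>j<q. B j)"
  proof (rule subsetI, rule ccontr)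
    fix \<omega> assume \<omega>: "\<omega> \<in> {\<omega> \<in> space M. 0 < excess x 0 \<omega> \<and> (\<Sum>k<m. excess x (Suc k) \<omega>) < q}"
      and not: "\<omega> \<notin> (\<Union>j<q. B j)"
    have "1 \<le> (\<Sum>k\<in>{j * l..<j * l + l}. excess x (Suc k) \<omega>)" if "j < q" for j
    proof -
      obtain k where k: "k \<in> {j * l..<j * l + l}" "excess x (Suc k) \<omega> \<noteq> 0"
        using not \<omega> \<open>j < q\<close> by (fastforce simp: B_def)
      have "excess x (Suc k) \<omega> \<le> (\<Sum>k\<in>{j * l..<j * l + l}. excess x (Suc k) \<omega>)"
        by (rule member_le_sum[OF k(1)]) auto
      with k(2) show ?thesis by linarith
    qed
    then have "(\<Sum>j<q. 1) \<le> (\<Sum>j<q. \<Sum>k\<in>{j * l..<j * l + l}. excess x (Suc k) \<omega>)"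
      by (intro sum_mono) auto
    also have "\<dots> = (\<Sum>k<q * l. excess x (Suc k) \<omega>)"
      by (rule sum.nat_group)
    also have "\<dots> \<le> (\<Sum>k<m. excess x (Suc k) \<omega>)"
      using l by (intro sum_mono2) auto
    finally show False using \<omega> by simp
  qed
  then have "\<P>(\<omega> in M. 0 < excess x 0 \<omega> \<and> (\<Sum>k<m. excess x (Suc k) \<omega>) < q) \<le> prob (\<Union>j<q. B j)"
    by (intro finite_measure_mono) auto
  also have "\<dots> \<le> (\<Sum>j<q. prob (B j))"
    by (rule finite_measure_subadditive_finite) auto
  also have "\<dots> = real q * prob (B 0)" by (simp add: prob_B)
  also have "\<dots> \<le> real q * first_cycle_dominates l"
    by (intro mult_left_mono B0) simp
  finally show ?thesis by (simp add: l_def)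
qed

section \<open>The uniform approximation\<close>

text \<open>
  With \<open>t = n / \<mu>\<close>, the \<open>n\<close>-th power of the phantom distribution function is the probability that a Poisson
  number with parameter \<open>- t * ln (max_cdf x)\<close> is 0. For \<open>n = 0\<close> and \<open>max_cdf x = 0\<close> this fails, since
  \<open>0 ^ 0 = 1\<close> but \<open>0 powr 0 = 0\<close>.
\<close>

lemma order_stat_approx_eq:
  assumes "1 \<le> n"
  shows "order_stat_approx M X S q n x =
    (\<Sum>k\<le>q - 1. poisson_weight k (real n / \<mu>) (max_cdf x) * cycle_gamma M X S q k x)"
proof -
  have "phantom_G M X S x ^ n = max_cdf x powr (real n / \<mu>)"
  proof (cases "max_cdf x = 0")
    case True
    then show ?thesis using assms by (simp add: phantom_G_def max_cdf_def)
  next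
    case False
    then have "0 < max_cdf x powr (1 / \<mu>)" by simp
    then have "(max_cdf x powr (1 / \<mu>)) ^ n = (max_cdf x powr (1 / \<mu>)) powr real n"
      by (simp add: powr_realpow)
    also have "\<dots> = max_cdf x powr (real n / \<mu>)" by (simp add: powr_powr)
    finally show ?thesis by (simp add: phantom_G_def max_cdf_def \<mu>_def)
  qed
  then show ?thesis
    by (simp add: order_stat_approx_def poisson_weight_def sum_distrib_left atLeast0AtMost mult_ac)
qed

lemma excess_sum_cdf_approx:
  assumes "2 \<le> q" "q \<le> r" "1 \<le> n"
  shows "\<bar>excess_sum_cdf x m (q - 1) - order_stat_approx M X S q n x\<bar> \<le>
    (\<Sum>k\<le>q - 1. \<bar>binomial_prob m (max_cdf x) k - poisson_weight k (real n / \<mu>) (max_cdf x)\<bar>)"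
proof -
  let ?d = "\<lambda>k. binomial_prob m (max_cdf x) k - poisson_weight k (real n / \<mu>) (max_cdf x)"
  have "\<bar>excess_sum_cdf x m (q - 1) - order_stat_approx M X S q n x\<bar> =
      \<bar>\<Sum>k\<le>q - 1. ?d k * cycle_gamma M X S q k x\<bar>"
    unfolding excess_sum_cdf_eq[OF assms(1,2)] order_stat_approx_eq[OF assms(3)]
    by (simp add: sum_subtractf left_diff_distrib)
  also have "\<dots> \<le> (\<Sum>k\<le>q - 1. \<bar>?d k * cycle_gamma M X S q k x\<bar>)" by (rule sum_abs)
  also have "\<dots> \<le> (\<Sum>k\<le>q - 1. \<bar>?d k\<bar>)"
  proof (rule sum_mono)
    fix k
    have "0 \<le> cycle_gamma M X S q k x" "cycle_gamma M X S q k x \<le> 1"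
      using cycle_gamma_bounds[OF assms(1,2), where k = k and x = x] by simp_all
    then show "\<bar>?d k * cycle_gamma M X S q k x\<bar> \<le> \<bar>?d k\<bar>"
      unfolding abs_mult by (simp add: mult_left_le)
  qed
  finally show ?thesis .
qed

lemma order_stat_uniform_approx:
  assumes q: "2 \<le> q" "q \<le> r"
    and dom: "first_cycle_dominates \<longlonglongrightarrow> 0"
    and "0 < \<epsilon>"
  shows "\<forall>\<^sub>F n in sequentially. \<forall>x.
    \<bar>\<P>(\<omega> in M. order_stat X q n \<omega> \<le> ereal x) - order_stat_approx M X S q n x\<bar> \<le> \<epsilon>"
proof -
  define \<eta> where "\<eta> = \<epsilon> / 3"
  have \<eta>: "0 < \<eta>" using \<open>0 < \<epsilon>\<close> by (simp add: \<eta>_def)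
  obtain c T where c: "0 < c" and unif: "\<And>t m F. T \<le> t \<Longrightarrow> \<bar>real m - t\<bar> \<le> c * t \<Longrightarrow> F \<in> {0..1} \<Longrightarrow>
      (\<Sum>k\<le>q - 1. \<bar>binomial_prob m F k - poisson_weight k t F\<bar>) \<le> \<eta>"
    using binomial_prob_uniform_approx_sum[OF \<eta>, of "q - 1"] by meson
  \<comment> \<open>The numbers of cycles \<open>m1 n\<close> and \<open>m2 n\<close> bracket \<open>t n\<close> with relative error \<open>a\<close>; the rest of \<open>c\<close> pays for rounding.\<close>
  define a where "a = min (c / 2) (1 / 2)"
  have a: "0 < a" "a \<le> 1 / 2" "2 * a \<le> c" using c by (auto simp: a_def)
  define t where "t n = real n / \<mu>" for n :: nat
  define m1 where "m1 n = nat \<lfloor>(1 - a) * t n\<rfloor>" for n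
  define m2 where "m2 n = nat \<lceil>(1 + a) * t n\<rceil>" for n
  have mu: "1 \<le> \<mu>" "\<mu> * t n = real n" "0 \<le> t n" for n
    using mean_ge_1 by (auto simp: t_def)
  have ev_t: "\<forall>\<^sub>F n in sequentially. b \<le> t n" for b
  proof -
    have "\<forall>\<^sub>F n in sequentially. b * \<mu> \<le> real n"
      using filterlim_real_sequentially unfolding filterlim_at_top by blast
    then show ?thesis by eventually_elim (use mu(1) in \<open>simp add: t_def pos_le_divide_eq\<close>)
  qed
  have m1_lim: "filterlim m1 at_top sequentially"
    unfolding filterlim_at_top
  proof
    fix Z
    show "\<forall>\<^sub>F n in sequentially. Z \<le> m1 n"
      using ev_t[of "2 * real Z"]
    proof eventually_elim
      case (elim n)
      have "(1 / 2) * t n \<le> (1 - a) * t n" using a mu(3) by (intro mult_right_mono) auto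
      then show ?case using elim by (simp add: m1_def le_nat_floor)
    qed
  qed
  have m2_lim: "filterlim m2 at_top sequentially"
    unfolding filterlim_at_top
  proof
    fix Z
    show "\<forall>\<^sub>F n in sequentially. Z \<le> m2 n"
      using ev_t[of "real Z"]
    proof eventually_elim
      case (elim n)
      have "1 * t n \<le> (1 + a) * t n" using a mu(3) by (intro mult_right_mono) auto
      then have "real Z \<le> real (m2 n)"
        using elim real_nat_ceiling_ge[of "(1 + a) * t n"] unfolding m2_def by linarith
      then show ?case by simp
    qed
  qed
  have "filterlim (\<lambda>n. m2 n div q) at_top sequentially"
    unfolding filterlim_at_top
  proof
    fix Z
    have "\<forall>\<^sub>F n in sequentially. Z * q \<le> m2 n" using m2_lim by (simp add: filterlim_at_top)
    then show "\<forall>\<^sub>F n in sequentially. Z \<le> m2 n div q"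
      by eventually_elim (use q in \<open>simp add: less_eq_div_iff_mult_less_eq\<close>)
  qed
  then have "(\<lambda>n. real q * first_cycle_dominates (m2 n div q)) \<longlonglongrightarrow> real q * 0"
    by (intro tendsto_intros filterlim_compose[OF dom])
  then have ev_dom: "\<forall>\<^sub>F n in sequentially. real q * first_cycle_dominates (m2 n div q) < \<eta>"
    by (rule order_tendstoD) (use \<eta> in simp)
  have ev_late: "\<forall>\<^sub>F n in sequentially. \<P>(\<omega> in M. (1 + a) * \<mu> * real (m1 n) \<le> real (S (m1 n) \<omega>)) < \<eta>"
    by (rule order_tendstoD(2)[OF filterlim_compose[OF regeneration_time_late[OF a(1)] m1_lim] \<eta>])
  \<comment> \<open>Half of \<open>a\<close> is left because \<open>(1 - a / 2) * (1 + a) \<ge> 1\<close>, whereas \<open>(1 - a) * (1 + a) < 1\<close>.\<close>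
  have a2: "0 < a / 2" using a by simp
  have ev_early: "\<forall>\<^sub>F n in sequentially. \<P>(\<omega> in M. real (S (m2 n) \<omega>) \<le> (1 - a / 2) * \<mu> * real (m2 n)) < \<eta>"
    by (rule order_tendstoD(2)[OF filterlim_compose[OF regeneration_time_early[OF a2] m2_lim] \<eta>])
  have ev_m2: "\<forall>\<^sub>F n in sequentially. q \<le> m2 n" using m2_lim by (simp add: filterlim_at_top)
  show ?thesis
    using ev_t[of T] ev_t[of "1 / a"] ev_dom ev_late ev_early ev_m2 eventually_ge_at_top[of 1]
  proof (eventually_elim, intro allI)
    fix n x
    assume T: "T \<le> t n" and "1 / a \<le> t n"
      and dom: "real q * first_cycle_dominates (m2 n div q) < \<eta>"
      and late: "\<P>(\<omega> in M. (1 + a) * \<mu> * real (m1 n) \<le> real (S (m1 n) \<omega>)) < \<eta>"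
      and early: "\<P>(\<omega> in M. real (S (m2 n) \<omega>) \<le> (1 - a / 2) * \<mu> * real (m2 n)) < \<eta>"
      and m2: "q \<le> m2 n" and n: "1 \<le> n"
    let ?P = "\<P>(\<omega> in M. order_stat X q n \<omega> \<le> ereal x)"
    let ?G = "order_stat_approx M X S q n x"
    have at: "1 \<le> a * t n" using \<open>1 / a \<le> t n\<close> a by (simp add: field_simps)
    have "2 * a * t n \<le> c * t n" using a mu(3) by (intro mult_right_mono) auto
    then have ct: "2 * (a * t n) \<le> c * t n" by simp
    have nonneg: "0 \<le> (1 - a) * t n" "0 \<le> (1 + a) * t n" using a mu(3) by auto
    have m1_bd: "real (m1 n) \<le> (1 - a) * t n" "(1 - a) * t n - 1 \<le> real (m1 n)"
      using nonneg unfolding m1_def by linarith+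
    have m2_bd: "(1 + a) * t n \<le> real (m2 n)" "real (m2 n) \<le> (1 + a) * t n + 1"
      using nonneg unfolding m2_def by linarith+
    have close: "\<bar>real (m1 n) - t n\<bar> \<le> c * t n" "\<bar>real (m2 n) - t n\<bar> \<le> c * t n"
      using m1_bd[unfolded left_diff_distrib] m2_bd[unfolded distrib_right] at ct
      by (simp_all only: abs_le_iff) linarith+
    have approx: "\<bar>excess_sum_cdf x m (q - 1) - ?G\<bar> \<le> \<eta>" if "\<bar>real m - t n\<bar> \<le> c * t n" for m
      using order_trans[OF excess_sum_cdf_approx[OF q n] unif[OF T that max_cdf_bounds, unfolded t_def]] .
    have "(1 + a) * \<mu> * real (m1 n) \<le> real n"
    proof -
      have "(1 + a) * \<mu> * real (m1 n) \<le> (1 + a) * \<mu> * ((1 - a) * t n)"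
        using m1_bd a mu by (intro mult_left_mono) auto
      also have "\<dots> = (1 - a * a) * (\<mu> * t n)" by (simp add: algebra_simps)
      also have "\<dots> \<le> 1 * (\<mu> * t n)" using mu by (intro mult_right_mono) auto
      finally show ?thesis by (simp add: mu)
    qed
    then have "\<P>(\<omega> in M. n + 1 < S (m1 n) \<omega>) \<le> \<P>(\<omega> in M. (1 + a) * \<mu> * real (m1 n) \<le> real (S (m1 n) \<omega>))"
      by (intro finite_measure_mono) auto
    moreover have "?P \<le> excess_sum_cdf x (m1 n) (q - 1) + \<P>(\<omega> in M. n + 1 < S (m1 n) \<omega>)"
      using q by (intro order_stat_prob_le) auto
    ultimately have upper: "?P \<le> ?G + 2 * \<eta>"
      using approx[OF close(1)] late by linarith
    have "real n \<le> (1 - a / 2) * \<mu> * real (m2 n)"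
    proof -
      have "1 * (\<mu> * t n) \<le> ((1 - a / 2) * (1 + a)) * (\<mu> * t n)"
      proof (rule mult_right_mono)
        have "a * a \<le> a * 1" using a by (intro mult_left_mono) auto
        then show "1 \<le> (1 - a / 2) * (1 + a)" by (simp add: algebra_simps)
      qed (use mu in simp)
      also have "\<dots> = (1 - a / 2) * \<mu> * ((1 + a) * t n)" by (simp add: mult_ac)
      also have "\<dots> \<le> (1 - a / 2) * \<mu> * real (m2 n)"
        using m2_bd a mu by (intro mult_left_mono) auto
      finally show ?thesis by (simp add: mu)
    qed
    then have "\<P>(\<omega> in M. S (m2 n) \<omega> \<le> n) \<le> \<P>(\<omega> in M. real (S (m2 n) \<omega>) \<le> (1 - a / 2) * \<mu> * real (m2 n))"
      by (intro finite_measure_mono) auto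
    moreover have "excess_sum_cdf x (m2 n) (q - 1) \<le> ?P +
        (\<P>(\<omega> in M. 0 < excess x 0 \<omega> \<and> (\<Sum>k<m2 n. excess x (Suc k) \<omega>) < q) + \<P>(\<omega> in M. S (m2 n) \<omega> \<le> n))"
      using q by (intro order_stat_prob_ge) auto
    moreover have "\<P>(\<omega> in M. 0 < excess x 0 \<omega> \<and> (\<Sum>k<m2 n. excess x (Suc k) \<omega>) < q) \<le>
        real q * first_cycle_dominates (m2 n div q)"
      using q m2 by (intro first_cycle_excess_bound) auto
    ultimately have lower: "?G \<le> ?P + 3 * \<eta>"
      using approx[OF close(2)] early dom by linarith
    have "3 * \<eta> = \<epsilon>" by (simp add: \<eta>_def)
    then show "\<bar>?P - ?G\<bar> \<le> \<epsilon>" using upper lower \<eta> by linarith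
  qed
qed

end

theorem theorem2:
  fixes M :: "'a measure" and X :: "nat \<Rightarrow> 'a \<Rightarrow> real" and S :: "nat \<Rightarrow> 'a \<Rightarrow> nat" and r :: nat
  assumes "prob_space M"
    and "r \<ge> 1"
    and "\<And>n. X n \<in> borel_measurable M"
    and "max_regenerative M r X S"
    and "integrable M (\<lambda>\<omega>. real (cycle_length S 1 \<omega>))"
    and "(\<lambda>n. \<P>(\<omega> in M. cycle_max X S 1 0 \<omega> > (MAX k\<in>{1..n}. cycle_max X S 1 k \<omega>)))
           \<longlonglongrightarrow> 0"
  shows "\<forall>q\<in>{2..r}.
           (\<forall>x. \<forall>k\<in>{0..q - 1}. cycle_gamma M X S q k x \<in> {0..1}) \<and>
           (\<lambda>n. SUP x. ereal \<bar>\<P>(\<omega> in M. order_stat X q n \<omega> \<le> ereal x)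
                              - order_stat_approx M X S q n x\<bar>) \<longlonglongrightarrow> 0"
proof (intro ballI conjI allI)
  interpret prob_space M by fact
  interpret max_regenerative_process M X S r
    by unfold_locales fact+
  fix q assume q: "q \<in> {2..r}"
  show "cycle_gamma M X S q k x \<in> {0..1}" for k x
    using cycle_gamma_bounds q by simp
  have dom: "first_cycle_dominates \<longlonglongrightarrow> 0"
    unfolding first_cycle_dominates_def by fact
  let ?d = "\<lambda>n x. ereal \<bar>\<P>(\<omega> in M. order_stat X q n \<omega> \<le> ereal x) - order_stat_approx M X S q n x\<bar>"
  show "(\<lambda>n. SUP x. ?d n x) \<longlonglongrightarrow> 0"
  proof (rule order_tendstoI)
    fix y :: ereal assume "y < 0"
    have "0 \<le> (SUP x. ?d n x)" for n
      by (rule SUP_upper2[of 0]) auto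
    then show "\<forall>\<^sub>F n in sequentially. y < (SUP x. ?d n x)"
      using \<open>y < 0\<close> by (intro always_eventually allI) (rule less_le_trans)
  next
    fix y :: ereal assume "0 < y"
    then obtain e where e: "0 < ereal e" "ereal e < y"
      using ereal_dense2 by blast
    then have "0 < e" by simp
    with q have "\<forall>\<^sub>F n in sequentially. \<forall>x.
        \<bar>\<P>(\<omega> in M. order_stat X q n \<omega> \<le> ereal x) - order_stat_approx M X S q n x\<bar> \<le> e"
      by (intro order_stat_uniform_approx dom) auto
    then show "\<forall>\<^sub>F n in sequentially. (SUP x. ?d n x) < y"
    proof eventually_elim
      case (elim n)
      then have "(SUP x. ?d n x) \<le> ereal e" by (intro SUP_least) simp
      with e show ?case by simp
    qed
  qed
qed

end
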